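(* The category $\mathrm{Disk}$ of disks is equivalent to the category $i\mathcal{I}$.
   Context: Intervals. For $n\ge0$ let $[n]=\{0,\dots,n\}$ with its usual order. $\mathcal{I}_+$ is the category whose objects (intervals) are the $[n]$ with $n\ge 0$ and whose morphisms are the order-preserving maps preserving the least and the greatest elements; these are the endpoints of $[n]$ (they coincide for $[0]$). An interval is strict if it is not $[0]$. An interval structure on a set is a linear order making it isomorphic to some $[n]$, $n\ge0$. The category $i\mathcal{I}_+$, defined inductively. The object of height $0$ is the interval $[0]$; it is called trivial (with $\mathrm{Ob}[0]=[0]$), and it is the only object whose underlying interval is $[0]$. For $n\ge1$, an object $H$ of height $n$ consists of an interval $\mathrm{Ob}\,H$ and, for each $i\in\mathrm{Ob}\,H$, an object $H(i)$ of height strictly less than $n$, such that $H(i)$ is trivial if and only if $i$ is an endpoint of $\mathrm{Ob}\,H$. For every object $H$ there is a unique morphism $H\to[0]$. For $K$ nontrivial, a morphism $g\colon H\to K$ consists of an interval map $g\colon\mathrm{Ob}\,H\to\mathrm{Ob}\,K$ and, for every $i\in\mathrm{Ob}\,H$, a morphism $g(i)\colon H(i)\to K(g i)$ (so there is none if $H$ is trivial). Composition: $(g\circ f)$ has object map the composite and $(g\circ f)(i)=g(f i)\circ f(i)$. $i\mathcal{I}$ is the full subcategory of $i\mathcal{I}_+$ on the nontrivial objects. Disks (Joyal). A tree $(A,p)$ is a sequence of sets $A_n$ ($n\ge0$) and maps $p_n\colon A_{n+1}\to A_n$ with $A_0$ a singleton (its element is the root). It has degree $n$ if for every $m\ge1$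 the composite $A_{n+m}\to A_n$ of the maps $p$ is a bijection, and finite degree if it has degree $n$ for some $n\in\mathbb{N}$. A disk is a tree $(A,p)$ of finite degree such that (1) each fiber of each $p_n\colon A_{n+1}\to A_n$ has an interval structure; (2) there are sections $d_0,d_1\colon A_n\to A_{n+1}$ of $p_n$ where $d_0(x)$ and $d_1(x)$ are the least and greatest elements of the fiber $p_n^{-1}(x)$; (3) for each $n\ge0$ the equalizer of $d_0,d_1\colon A_n\to A_{n+1}$ is $d_0(A_{n-1})\cup d_1(A_{n-1})$ (with $A_{-1}=\emptyset$; in particular the fiber over the root is a strict interval). A morphism of disks $f\colon(A,p)\to(B,q)$ is a sequence of maps $f_n\colon A_n\to B_n$ commuting with the projections, preserving the order of the interval fibers, and preserving the first and last elements of the fibers. This defines the category $\mathrm{Disk}$. *)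

theory Defs
  imports Main "HOL-Library.FuncSet"
begin

section \<open>Categories and equivalences\<close>

text \<open>
  Categories are presented by hom-sets. These need not be pairwise disjoint, so composition
  receives the three objects: \<open>Comp C X Y Z g f\<close> is \<open>g \<circ> f\<close> for \<open>f : X \<rightarrow> Y\<close> and \<open>g : Y \<rightarrow> Z\<close>.
\<close>

record ('o, 'm) cat =
  Obj :: "'o set"
  Hom :: "'o \<Rightarrow> 'o \<Rightarrow> 'm set"
  Ident :: "'o \<Rightarrow> 'm"
  Comp :: "'o \<Rightarrow> 'o \<Rightarrow> 'o \<Rightarrow> 'm \<Rightarrow> 'm \<Rightarrow> 'm"

locale category =
  fixes C :: "('o, 'm) cat"
  assumes Ident_in: "X \<in> Obj C \<Longrightarrow> Ident C X \<in> Hom C X X"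
    and Comp_in: "\<lbrakk>X \<in> Obj C; Y \<in> Obj C; Z \<in> Obj C; f \<in> Hom C X Y; g \<in> Hom C Y Z\<rbrakk>
      \<Longrightarrow> Comp C X Y Z g f \<in> Hom C X Z"
    and Comp_Ident_right: "\<lbrakk>X \<in> Obj C; Y \<in> Obj C; f \<in> Hom C X Y\<rbrakk>
      \<Longrightarrow> Comp C X X Y f (Ident C X) = f"
    and Comp_Ident_left: "\<lbrakk>X \<in> Obj C; Y \<in> Obj C; f \<in> Hom C X Y\<rbrakk>
      \<Longrightarrow> Comp C X Y Y (Ident C Y) f = f"
    and Comp_assoc: "\<lbrakk>W \<in> Obj C; X \<in> Obj C; Y \<in> Obj C; Z \<in> Obj C;
        f \<in> Hom C W X; g \<in> Hom C X Y; h \<in> Hom C Y Z\<rbrakk>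
      \<Longrightarrow> Comp C W Y Z h (Comp C W X Y g f) = Comp C W X Z (Comp C X Y Z h g) f"

definition full_subcategory :: "('o, 'm) cat \<Rightarrow> 'o set \<Rightarrow> ('o, 'm) cat" where
  "full_subcategory C S = C\<lparr>Obj := Obj C \<inter> S\<rparr>"

record ('o, 'm, 'p, 'n) funct =
  on_obj :: "'o \<Rightarrow> 'p"
  on_mor :: "'o \<Rightarrow> 'o \<Rightarrow> 'm \<Rightarrow> 'n"

definition is_functor :: "('o, 'm) cat \<Rightarrow> ('p, 'n) cat \<Rightarrow> ('o, 'm, 'p, 'n) funct \<Rightarrow> bool" where
  "is_functor C D F \<longleftrightarrow>
    (\<forall>X\<in>Obj C. on_obj F X \<in> Obj D) \<and>
    (\<forall>X\<in>Obj C. \<forall>Y\<in>Obj C. \<forall>f\<in>Hom C X Y. on_mor F X Y f \<in> Hom D (on_obj F X) (on_obj F Y)) \<and>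
    (\<forall>X\<in>Obj C. on_mor F X X (Ident C X) = Ident D (on_obj F X)) \<and>
    (\<forall>X\<in>Obj C. \<forall>Y\<in>Obj C. \<forall>Z\<in>Obj C. \<forall>f\<in>Hom C X Y. \<forall>g\<in>Hom C Y Z.
      on_mor F X Z (Comp C X Y Z g f) =
        Comp D (on_obj F X) (on_obj F Y) (on_obj F Z) (on_mor F Y Z g) (on_mor F X Y f))"

definition id_functor :: "('o, 'm, 'o, 'm) funct" where
  "id_functor = \<lparr>on_obj = (\<lambda>X. X), on_mor = (\<lambda>X Y f. f)\<rparr>"

definition comp_functor ::
    "('p, 'n, 'q, 'k) funct \<Rightarrow> ('o, 'm, 'p, 'n) funct \<Rightarrow> ('o, 'm, 'q, 'k) funct" where
  "comp_functor G F =
    \<lparr>on_obj = (\<lambda>X. on_obj G (on_obj F X)),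
     on_mor = (\<lambda>X Y f. on_mor G (on_obj F X) (on_obj F Y) (on_mor F X Y f))\<rparr>"

definition is_iso :: "('o, 'm) cat \<Rightarrow> 'o \<Rightarrow> 'o \<Rightarrow> 'm \<Rightarrow> bool" where
  "is_iso C X Y f \<longleftrightarrow> f \<in> Hom C X Y \<and>
    (\<exists>g\<in>Hom C Y X. Comp C X Y X g f = Ident C X \<and> Comp C Y X Y f g = Ident C Y)"

definition is_natural_iso ::
    "('o, 'm) cat \<Rightarrow> ('p, 'n) cat \<Rightarrow> ('o, 'm, 'p, 'n) funct \<Rightarrow> ('o, 'm, 'p, 'n) funct
      \<Rightarrow> ('o \<Rightarrow> 'n) \<Rightarrow> bool" where
  "is_natural_iso C D F G \<eta> \<longleftrightarrow>
    (\<forall>X\<in>Obj C. is_iso D (on_obj F X) (on_obj G X) (\<eta> X)) \<and>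
    (\<forall>X\<in>Obj C. \<forall>Y\<in>Obj C. \<forall>f\<in>Hom C X Y.
      Comp D (on_obj F X) (on_obj F Y) (on_obj G Y) (\<eta> Y) (on_mor F X Y f) =
      Comp D (on_obj F X) (on_obj G X) (on_obj G Y) (on_mor G X Y f) (\<eta> X))"

definition equivalent_categories :: "('o, 'm) cat \<Rightarrow> ('p, 'n) cat \<Rightarrow> bool" where
  "equivalent_categories C D \<longleftrightarrow> category C \<and> category D \<and>
    (\<exists>F G \<eta> \<epsilon>. is_functor C D F \<and> is_functor D C G \<and>
      is_natural_iso C C id_functor (comp_functor G F) \<eta> \<and>
      is_natural_iso D D (comp_functor F G) id_functor \<epsilon>)"

section \<open>Intervals\<close>

text \<open>The interval \<open>[n]\<close> is \<open>{0..n}\<close>; it is represented by \<open>n\<close>.\<close>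

definition interval_map :: "nat \<Rightarrow> nat \<Rightarrow> (nat \<Rightarrow> nat) \<Rightarrow> bool" where
  "interval_map m n g \<longleftrightarrow>
    g ` {0..m} \<subseteq> {0..n} \<and> mono_on {0..m} g \<and> g 0 = 0 \<and> g m = n"

definition interval_structure :: "'a set \<Rightarrow> 'a rel \<Rightarrow> bool" where
  "interval_structure X r \<longleftrightarrow> linear_order_on X r \<and>
    (\<exists>n \<phi>. bij_betw \<phi> X {0..n::nat} \<and> (\<forall>x\<in>X. \<forall>y\<in>X. (x, y) \<in> r \<longleftrightarrow> \<phi> x \<le> \<phi> y))"

definition is_least :: "'a set \<Rightarrow> 'a rel \<Rightarrow> 'a \<Rightarrow> bool" where
  "is_least X r x \<longleftrightarrow> x \<in> X \<and> (\<forall>y\<in>X. (x, y) \<in> r)"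

definition is_greatest :: "'a set \<Rightarrow> 'a rel \<Rightarrow> 'a \<Rightarrow> bool" where
  "is_greatest X r x \<longleftrightarrow> x \<in> X \<and> (\<forall>y\<in>X. (y, x) \<in> r)"

section \<open>The category of iterated intervals\<close>

text \<open>
  \<open>Trivial\<close> is the object \<open>[0]\<close> of height 0; \<open>Node [H\<^sub>0, \<dots>, H\<^sub>m]\<close> is the object \<open>H\<close> with
  \<open>Ob H = [m]\<close> and \<open>H(i) = H\<^sub>i\<close>. The convention \<open>sub Trivial i = Trivial\<close> is immaterial:
  it only makes \<open>sub\<close> total.
\<close>

datatype iobj = Trivial | Node "iobj list"

fun top_ob :: "iobj \<Rightarrow> nat" where
  "top_ob Trivial = 0"
| "top_ob (Node Hs) = length Hs - 1"

definition Ob :: "iobj \<Rightarrow> nat set" where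
  "Ob H = {0..top_ob H}"

fun sub :: "iobj \<Rightarrow> nat \<Rightarrow> iobj" where
  "sub Trivial i = Trivial"
| "sub (Node Hs) i = Hs ! i"

text \<open>
  \<open>has_height n H\<close>: \<open>H\<close> is an object of height \<open>n\<close>. As heights of constituents are only required
  to be smaller than \<open>n\<close>, a nontrivial object of height \<open>n\<close> is also one of every larger height.
  The condition \<open>2 \<le> length Hs\<close> says that the underlying interval is strict, \<open>Trivial\<close> being
  the only object with underlying interval \<open>[0]\<close>.
\<close>

inductive has_height :: "nat \<Rightarrow> iobj \<Rightarrow> bool" where
  trivial: "has_height 0 Trivial"
| node: "\<lbrakk>1 \<le> n; 2 \<le> length Hs;
    \<forall>i\<in>Ob (Node Hs). \<exists>k<n. has_height k (sub (Node Hs) i);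
    \<forall>i\<in>Ob (Node Hs). sub (Node Hs) i = Trivial \<longleftrightarrow> i = 0 \<or> i = top_ob (Node Hs)\<rbrakk>
    \<Longrightarrow> has_height n (Node Hs)"

text \<open>
  \<open>ToTrivial\<close> is the unique morphism to \<open>[0]\<close>; \<open>IMor [(g 0, g(0)), \<dots>, (g m, g(m))]\<close> is the
  morphism \<open>g\<close> with object map \<open>i \<mapsto> g i\<close> and components \<open>g(i)\<close>.
\<close>

datatype imor = ToTrivial | IMor "(nat \<times> imor) list"

inductive is_imor :: "iobj \<Rightarrow> iobj \<Rightarrow> imor \<Rightarrow> bool" where
  to_trivial: "is_imor H Trivial ToTrivial"
| imor: "\<lbrakk>K \<noteq> Trivial; length gs = Suc (top_ob H);
    interval_map (top_ob H) (top_ob K) (\<lambda>i. fst (gs ! i));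
    \<forall>i\<in>Ob H. is_imor (sub H i) (sub K (fst (gs ! i))) (snd (gs ! i))\<rbrakk>
    \<Longrightarrow> is_imor H K (IMor gs)"

fun iid :: "iobj \<Rightarrow> imor" where
  "iid Trivial = ToTrivial"
| "iid (Node Hs) = IMor (zip [0..<length Hs] (map iid Hs))"

text \<open>
  \<open>icomp g f\<close> is \<open>g \<circ> f\<close>: at position \<open>i\<close> of \<open>f\<close>, which holds \<open>(j, d) = (f i, f(i))\<close>, the
  composite has \<open>(g (f i), g(f i) \<circ> f(i))\<close>. If \<open>f\<close> is \<open>ToTrivial\<close>, then so is any \<open>g\<close>
  composable with it.
\<close>

fun icomp :: "imor \<Rightarrow> imor \<Rightarrow> imor" where
  "icomp (IMor gs) (IMor fs) = IMor (map (\<lambda>(j, d). (fst (gs ! j), icomp (snd (gs ! j)) d)) fs)"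
| "icomp ToTrivial f = ToTrivial"
| "icomp (IMor gs) ToTrivial = ToTrivial"

definition iI_plus :: "(iobj, imor) cat" where
  "iI_plus = \<lparr>Obj = {H. \<exists>n. has_height n H}, Hom = (\<lambda>H K. {g. is_imor H K g}),
    Ident = iid, Comp = (\<lambda>H K L g f. icomp g f)\<rparr>"

definition iI :: "(iobj, imor) cat" where
  "iI = full_subcategory iI_plus {H. H \<noteq> Trivial}"

section \<open>The category of disks\<close>

text \<open>
  The sets \<open>lev A n\<close> are subsets of a type \<open>'a\<close> (not required to be disjoint), and
  \<open>proj A n : lev A (Suc n) \<rightarrow> lev A n\<close>.
\<close>

record 'a tree =
  lev :: "nat \<Rightarrow> 'a set"
  proj :: "nat \<Rightarrow> 'a \<Rightarrow> 'a"

definition is_tree :: "('a, 'z) tree_scheme \<Rightarrow> bool" where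
  "is_tree A \<longleftrightarrow> (\<exists>r. lev A 0 = {r}) \<and> (\<forall>n. proj A n \<in> lev A (Suc n) \<rightarrow>\<^sub>E lev A n)"

definition fiber :: "('a, 'z) tree_scheme \<Rightarrow> nat \<Rightarrow> 'a \<Rightarrow> 'a set" where
  "fiber A n x = {y \<in> lev A (Suc n). proj A n y = x}"

text \<open>\<open>proj_comp A n m\<close> is the composite of projections from level \<open>n + m\<close> to level \<open>n\<close>.\<close>

primrec proj_comp :: "('a, 'z) tree_scheme \<Rightarrow> nat \<Rightarrow> nat \<Rightarrow> 'a \<Rightarrow> 'a" where
  "proj_comp A n 0 = (\<lambda>x. x)"
| "proj_comp A n (Suc m) = proj_comp A n m \<circ> proj A (n + m)"

definition has_degree :: "('a, 'z) tree_scheme \<Rightarrow> nat \<Rightarrow> bool" where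
  "has_degree A n \<longleftrightarrow> (\<forall>m\<ge>1. bij_betw (proj_comp A n m) (lev A (n + m)) (lev A n))"

definition finite_degree :: "('a, 'z) tree_scheme \<Rightarrow> bool" where
  "finite_degree A \<longleftrightarrow> (\<exists>n. has_degree A n)"

text \<open>
  \<open>ford A n x\<close> is the order on the fiber over \<open>x \<in> lev A n\<close>; for \<open>x\<close> outside \<open>lev A n\<close> it is
  normalized to be empty, so that it carries no information there.
\<close>

record 'a disk = "'a tree" +
  ford :: "nat \<Rightarrow> 'a \<Rightarrow> 'a rel"

definition is_disk :: "'a disk \<Rightarrow> bool" where
  "is_disk A \<longleftrightarrow> is_tree A \<and> finite_degree A \<and>
    (\<forall>n. \<forall>x\<in>lev A n. interval_structure (fiber A n x) (ford A n x)) \<and>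
    (\<forall>n x. x \<notin> lev A n \<longrightarrow> ford A n x = {}) \<and>
    (\<exists>d\<^sub>0 d\<^sub>1 :: nat \<Rightarrow> 'a \<Rightarrow> 'a.
      (\<forall>n. \<forall>x\<in>lev A n. is_least (fiber A n x) (ford A n x) (d\<^sub>0 n x) \<and>
        is_greatest (fiber A n x) (ford A n x) (d\<^sub>1 n x)) \<and>
      {x \<in> lev A 0. d\<^sub>0 0 x = d\<^sub>1 0 x} = {} \<and>
      (\<forall>n. {x \<in> lev A (Suc n). d\<^sub>0 (Suc n) x = d\<^sub>1 (Suc n) x} =
        d\<^sub>0 n ` lev A n \<union> d\<^sub>1 n ` lev A n))"

definition is_disk_mor :: "'a disk \<Rightarrow> 'a disk \<Rightarrow> (nat \<Rightarrow> 'a \<Rightarrow> 'a) \<Rightarrow> bool" where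
  "is_disk_mor A B f \<longleftrightarrow>
    (\<forall>n. f n \<in> lev A n \<rightarrow>\<^sub>E lev B n) \<and>
    (\<forall>n. \<forall>y\<in>lev A (Suc n). proj B n (f (Suc n) y) = f n (proj A n y)) \<and>
    (\<forall>n. \<forall>x\<in>lev A n. \<forall>y\<in>fiber A n x. \<forall>z\<in>fiber A n x.
      (y, z) \<in> ford A n x \<longrightarrow> (f (Suc n) y, f (Suc n) z) \<in> ford B n (f n x)) \<and>
    (\<forall>n. \<forall>x\<in>lev A n. \<forall>y.
      (is_least (fiber A n x) (ford A n x) y \<longrightarrow>
        is_least (fiber B n (f n x)) (ford B n (f n x)) (f (Suc n) y)) \<and>
      (is_greatest (fiber A n x) (ford A n x) y \<longrightarrow>
        is_greatest (fiber B n (f n x)) (ford B n (f n x)) (f (Suc n) y)))"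

text \<open>
  All levels of a disk are finite, so over an infinite type \<open>'a\<close> every disk is isomorphic to one
  whose levels are subsets of \<open>'a\<close>.
\<close>

definition Disk :: "('a disk, nat \<Rightarrow> 'a \<Rightarrow> 'a) cat" where
  "Disk = \<lparr>Obj = {A. is_disk A}, Hom = (\<lambda>A B. {f. is_disk_mor A B f}),
    Ident = (\<lambda>A n. \<lambda>x\<in>lev A n. x),
    Comp = (\<lambda>A B C g f n. compose (lev A n) (g n) (f n))\<rparr>"

end

theory Submission
  imports Defs "HOL-Library.Countable"
begin

text \<open>
  A disk and an iterated interval are two descriptions of the same thing. An object \<open>H\<close> of \<open>iI\<close>
  is an interval with a smaller object attached to each of its elements; a disk lists, level by
  level, the elements met when one keeps descending into the attached objects. So \<open>H\<close> yields a
  disk whose elements of level \<open>n\<close> are the paths \<open>[i\<^sub>1, \<dots>, i\<^sub>n]\<close> with \<open>i\<^sub>1\<close> in \<open>Ob H\<close>, \<open>i\<^sub>2\<close> in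
  \<open>Ob (H(i\<^sub>1))\<close>, and so on, and whose fiber over such a path is the underlying interval of
  \<open>H(i\<^sub>1)\<dots>(i\<^sub>n)\<close>. Finiteness of the height becomes finiteness of the degree, and the rule that
  \<open>H(i)\<close> is trivial exactly at the endpoints becomes the equalizer condition on the sections
  \<open>d\<^sub>0\<close> and \<open>d\<^sub>1\<close> (\<open>is_disk_path_disk\<close>).

  This construction is a functor from \<open>iI\<close> to disks, and it suffices that it is fully faithful and
  essentially surjective (\<open>equivalent_categories_if_fully_faithful\<close>).

  Fully faithful: a morphism of iterated intervals acts on paths, entry by entry. A morphism of
  disks is the same as a map on paths which on the continuations of every single path is an
  interval map (\<open>path_map\<close>). Such a map is the action of exactly one morphism, by recursion: its
  restriction to paths of length one is the object map, and its restriction to the paths through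
  \<open>i\<close> is the component at \<open>i\<close> (\<open>is_imor_eqI\<close>, \<open>path_map_is_mor_path\<close>). The faithful action on paths
  also yields the category laws of \<open>iI\<close>, since composition of maps is associative.

  Essentially surjective: enumerate all fibers of a disk in increasing order and read the disk as
  an iterated interval by descending from the root, stopping at singleton fibers; the descent ends
  because the degree is finite. Every path of the resulting object names an element of the disk,
  and this assignment is an isomorphism, being an enumeration on each fiber (\<open>path_disk_iso\<close>).
\<close>

section \<open>Equivalences from fully faithful functors\<close>

definition fully_faithful ::
    "('o, 'm) cat \<Rightarrow> ('p, 'n) cat \<Rightarrow> ('o, 'm, 'p, 'n) funct \<Rightarrow> bool" where
  "fully_faithful C D F \<longleftrightarrow> (\<forall>X\<in>Obj C. \<forall>Y\<in>Obj C.
    bij_betw (on_mor F X Y) (Hom C X Y) (Hom D (on_obj F X) (on_obj F Y)))"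

definition essentially_surjective ::
    "('o, 'm) cat \<Rightarrow> ('p, 'n) cat \<Rightarrow> ('o, 'm, 'p, 'n) funct \<Rightarrow> bool" where
  "essentially_surjective C D F \<longleftrightarrow> (\<forall>Y\<in>Obj D. \<exists>X\<in>Obj C. \<exists>h. is_iso D Y (on_obj F X) h)"

text \<open>
  The construction of a quasi-inverse chooses, for every object \<open>Y\<close> of the target, an object
  \<open>S Y\<close> and an isomorphism \<open>u Y : Y \<rightarrow> F (S Y)\<close> with inverse \<open>v Y\<close>, and pulls the conjugates
  \<open>u Z \<circ> f \<circ> v Y\<close> back along the bijections of hom-sets. As \<open>F\<close> reflects equations between
  morphisms, every identity to be checked in \<open>C\<close> becomes one in \<open>D\<close> in which pairs \<open>v Y \<circ> u Y\<close>
  or \<open>u Y \<circ> v Y\<close> cancel.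
\<close>

theorem equivalent_categories_if_fully_faithful:
  fixes C :: "('o, 'm) cat" and D :: "('p, 'n) cat"
  assumes "category C" and "category D" and F: "is_functor C D F"
    and ff: "fully_faithful C D F" and es: "essentially_surjective C D F"
  shows "equivalent_categories D C"
proof -
  interpret C: category C by fact
  interpret D: category D by fact
  let ?F = "on_obj F"
  obtain S u where S_iso: "\<And>Y. Y \<in> Obj D \<Longrightarrow> S Y \<in> Obj C \<and> is_iso D Y (?F (S Y)) (u Y)"
    using es unfolding essentially_surjective_def by metis
  then obtain v where "\<And>Y. Y \<in> Obj D \<Longrightarrow> v Y \<in> Hom D (?F (S Y)) Y \<and>
      Comp D Y (?F (S Y)) Y (v Y) (u Y) = Ident D Y \<and>
      Comp D (?F (S Y)) Y (?F (S Y)) (u Y) (v Y) = Ident D (?F (S Y))"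
    unfolding is_iso_def by metis
  with S_iso have S [simp]: "Y \<in> Obj D \<Longrightarrow> S Y \<in> Obj C"
    and u [simp]: "Y \<in> Obj D \<Longrightarrow> u Y \<in> Hom D Y (?F (S Y))"
    and v [simp]: "Y \<in> Obj D \<Longrightarrow> v Y \<in> Hom D (?F (S Y)) Y"
    and vu [simp]: "Y \<in> Obj D \<Longrightarrow> Comp D Y (?F (S Y)) Y (v Y) (u Y) = Ident D Y"
    and uv [simp]: "Y \<in> Obj D \<Longrightarrow>
      Comp D (?F (S Y)) Y (?F (S Y)) (u Y) (v Y) = Ident D (?F (S Y))" for Y
    by (auto simp: is_iso_def)
  have F_obj [simp]: "X \<in> Obj C \<Longrightarrow> ?F X \<in> Obj D" for X
    using F by (simp add: is_functor_def)
  have F_mor [simp]: "on_mor F X Y f \<in> Hom D (?F X) (?F Y)"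
    if "X \<in> Obj C" "Y \<in> Obj C" "f \<in> Hom C X Y" for X Y f
    using F that by (simp add: is_functor_def)
  have F_id [simp]: "X \<in> Obj C \<Longrightarrow> on_mor F X X (Ident C X) = Ident D (?F X)" for X
    using F by (simp add: is_functor_def)
  have F_comp [simp]: "on_mor F X Z (Comp C X Y Z g f) =
      Comp D (?F X) (?F Y) (?F Z) (on_mor F Y Z g) (on_mor F X Y f)"
    if "X \<in> Obj C" "Y \<in> Obj C" "Z \<in> Obj C" "f \<in> Hom C X Y" "g \<in> Hom C Y Z" for X Y Z f g
    using F that by (simp add: is_functor_def)
  define lift where "lift X Y = inv_into (Hom C X Y) (on_mor F X Y)" for X Y
  have lift_in [simp]: "lift X Y h \<in> Hom C X Y"
    and F_lift [simp]: "on_mor F X Y (lift X Y h) = h"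
    if "X \<in> Obj C" "Y \<in> Obj C" "h \<in> Hom D (?F X) (?F Y)" for X Y h
  proof -
    have "on_mor F X Y ` Hom C X Y = Hom D (?F X) (?F Y)"
      using ff that by (auto simp: fully_faithful_def bij_betw_def)
    then show "lift X Y h \<in> Hom C X Y" "on_mor F X Y (lift X Y h) = h"
      unfolding lift_def using that by (auto intro: inv_into_into f_inv_into_f)
  qed
  have faithful: "f = g" if "on_mor F X Y f = on_mor F X Y g"
    "X \<in> Obj C" "Y \<in> Obj C" "f \<in> Hom C X Y" "g \<in> Hom C X Y" for X Y f g
    using ff that by (auto simp: fully_faithful_def bij_betw_def inj_on_def)
  note [simp] = C.Ident_in C.Comp_in D.Ident_in D.Comp_in D.Comp_Ident_left D.Comp_Ident_right
    D.Comp_assoc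
  \<comment> \<open>composites are normalized to left-nested form, so cancellation is needed below a further map \<open>h\<close>\<close>
  have vu_cancel [simp]: "Comp D Y (?F (S Y)) Z (Comp D (?F (S Y)) Y Z h (v Y)) (u Y) = h"
    if "Y \<in> Obj D" "Z \<in> Obj D" "h \<in> Hom D Y Z" for Y Z h
    using D.Comp_assoc[of Y "?F (S Y)" Y Z "u Y" "v Y" h] that by (simp del: D.Comp_assoc)
  define G where "G = \<lparr>on_obj = S,
    on_mor = (\<lambda>Y Z f. lift (S Y) (S Z)
      (Comp D (?F (S Y)) Y (?F (S Z)) (Comp D Y Z (?F (S Z)) (u Z) f) (v Y)))\<rparr>"
  define \<epsilon> where "\<epsilon> X = lift (S (?F X)) X (v (?F X))" for X
  have "is_functor D C G"
    unfolding is_functor_def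
  proof (intro conjI ballI)
    fix X assume "X \<in> Obj D"
    then show "on_mor G X X (Ident D X) = Ident C (on_obj G X)"
      unfolding G_def by (auto intro: faithful[where X = "S X" and Y = "S X"])
  next
    fix X Y Z f g
    assume "X \<in> Obj D" "Y \<in> Obj D" "Z \<in> Obj D" "f \<in> Hom D X Y" "g \<in> Hom D Y Z"
    then show "on_mor G X Z (Comp D X Y Z g f) =
      Comp C (on_obj G X) (on_obj G Y) (on_obj G Z) (on_mor G Y Z g) (on_mor G X Y f)"
      unfolding G_def by (auto intro: faithful[where X = "S X" and Y = "S Z"])
  qed (simp_all add: G_def)
  moreover have "is_natural_iso D D id_functor (comp_functor F G) u"
    unfolding is_natural_iso_def
  proof (intro conjI ballI)
    fix Y assume "Y \<in> Obj D"
    then show "is_iso D (on_obj id_functor Y) (on_obj (comp_functor F G) Y) (u Y)"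
      using S_iso by (simp add: id_functor_def comp_functor_def G_def)
  qed (simp add: id_functor_def comp_functor_def G_def)
  moreover have "is_natural_iso C C (comp_functor G F) id_functor \<epsilon>"
    unfolding is_natural_iso_def
  proof (intro conjI ballI)
    fix X assume X: "X \<in> Obj C"
    let ?\<delta> = "lift X (S (?F X)) (u (?F X))"
    have "Comp C (S (?F X)) X (S (?F X)) ?\<delta> (\<epsilon> X) = Ident C (S (?F X))"
      using X by (auto intro: faithful[where X = "S (?F X)" and Y = "S (?F X)"] simp: \<epsilon>_def)
    moreover have "Comp C X (S (?F X)) X (\<epsilon> X) ?\<delta> = Ident C X"
      using X by (auto intro: faithful[where X = X and Y = X] simp: \<epsilon>_def)
    ultimately show "is_iso C (on_obj (comp_functor G F) X) (on_obj id_functor X) (\<epsilon> X)"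
      using X unfolding is_iso_def
      by (auto simp: id_functor_def comp_functor_def G_def \<epsilon>_def intro!: bexI[of _ ?\<delta>])
  next
    fix X Y f assume XY: "X \<in> Obj C" "Y \<in> Obj C" and f: "f \<in> Hom C X Y"
    show "Comp C (on_obj (comp_functor G F) X) (on_obj (comp_functor G F) Y) (on_obj id_functor Y)
        (\<epsilon> Y) (on_mor (comp_functor G F) X Y f) =
      Comp C (on_obj (comp_functor G F) X) (on_obj id_functor X) (on_obj id_functor Y)
        (on_mor id_functor X Y f) (\<epsilon> X)"
      using XY f by (auto intro: faithful[where X = "S (?F X)" and Y = Y] simp: id_functor_def comp_functor_def G_def \<epsilon>_def)
  qed
  ultimately show ?thesis
    using F \<open>category C\<close> \<open>category D\<close> unfolding equivalent_categories_def by blast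
qed

section \<open>Paths in iterated intervals\<close>

text \<open>
  A path records the choices made while descending into \<open>H\<close>: an element \<open>i\<close> of \<open>Ob H\<close>, then
  one of \<open>Ob (H(i))\<close>, and so on. The descent never stops: below a trivial object there is the
  single choice \<open>0\<close>, just as a disk continues below every endpoint by one-element fibers.
\<close>

fun is_path :: "iobj \<Rightarrow> nat list \<Rightarrow> bool" where
  "is_path H [] \<longleftrightarrow> True"
| "is_path H (i # p) \<longleftrightarrow> i \<le> top_ob H \<and> is_path (sub H i) p"

abbreviation sub_at :: "iobj \<Rightarrow> nat list \<Rightarrow> iobj" where
  "sub_at \<equiv> foldl sub"

lemma is_path_append: "is_path H (p @ q) \<longleftrightarrow> is_path H p \<and> is_path (sub_at H p) q"
  by (induction p arbitrary: H) auto

lemma path_SucE: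
  assumes "is_path H q" "length q = Suc n"
  obtains p i where "q = p @ [i]" "is_path H p" "length p = n" "i \<le> top_ob (sub_at H p)"
proof (cases q rule: rev_exhaust)
  case (snoc p i)
  with assms that show thesis by (auto simp: is_path_append)
qed (use assms in simp)

text \<open>
  The value \<open>0\<close> of \<open>mor_ob ToTrivial\<close> is the only element of \<open>[0]\<close>, and every component of the
  morphism to \<open>[0]\<close> is again the morphism to \<open>[0]\<close>. With these two conventions morphisms act on
  paths of every length, with no case distinction between trivial and nontrivial codomains.
\<close>

fun mor_ob :: "imor \<Rightarrow> nat \<Rightarrow> nat" where
  "mor_ob ToTrivial i = 0"
| "mor_ob (IMor gs) i = fst (gs ! i)"

fun mor_sub :: "imor \<Rightarrow> nat \<Rightarrow> imor" where
  "mor_sub ToTrivial i = ToTrivial"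
| "mor_sub (IMor gs) i = snd (gs ! i)"

fun mor_path :: "imor \<Rightarrow> nat list \<Rightarrow> nat list" where
  "mor_path g [] = []"
| "mor_path g (i # p) = mor_ob g i # mor_path (mor_sub g i) p"

abbreviation mor_at :: "imor \<Rightarrow> nat list \<Rightarrow> imor" where
  "mor_at \<equiv> foldl mor_sub"

lemma mor_path_append: "mor_path g (p @ q) = mor_path g p @ mor_path (mor_at g p) q"
  by (induction p arbitrary: g) auto

lemma interval_map_cong:
  assumes "\<And>i. i \<le> m \<Longrightarrow> f i = g i"
  shows "interval_map m n f \<longleftrightarrow> interval_map m n g"
  using assms unfolding interval_map_def mono_on_def by (auto simp: image_subset_iff)

lemma interval_map_le: "interval_map m n g \<Longrightarrow> i \<le> m \<Longrightarrow> g i \<le> n"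
  by (auto simp: interval_map_def image_subset_iff)

lemma interval_map_id: "interval_map m m (\<lambda>i. i)"
  by (auto simp: interval_map_def mono_on_def)

lemma interval_map_comp:
  "interval_map k m f \<Longrightarrow> interval_map m n g \<Longrightarrow> interval_map k n (\<lambda>i. g (f i))"
  unfolding interval_map_def mono_on_def by (auto simp: image_subset_iff)

lemma is_imor_mor_ob: "is_imor H K g \<Longrightarrow> interval_map (top_ob H) (top_ob K) (mor_ob g)"
  by (induction rule: is_imor.induct) (auto simp: interval_map_def mono_on_def)

lemma is_imor_mor_sub:
  "is_imor H K g \<Longrightarrow> i \<le> top_ob H \<Longrightarrow> is_imor (sub H i) (sub K (mor_ob g i)) (mor_sub g i)"
  by (erule is_imor.cases) (auto simp: Ob_def intro: is_imor.to_trivial)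

lemma is_imor_mor_at:
  "is_imor H K g \<Longrightarrow> is_path H p \<Longrightarrow>
    is_imor (sub_at H p) (sub_at K (mor_path g p)) (mor_at g p)"
  by (induction p arbitrary: H K g) (auto dest: is_imor_mor_sub)

text \<open>
  The maps on paths that come from morphisms of disks: one step below each path they are an
  interval map between the two intervals of possible continuations. Preservation of length and
  compatibility with cutting off the last entry are implied.
\<close>

definition path_map :: "iobj \<Rightarrow> iobj \<Rightarrow> (nat list \<Rightarrow> nat list) \<Rightarrow> bool" where
  "path_map H K F \<longleftrightarrow> F [] = [] \<and> (\<forall>p. is_path H p \<longrightarrow>
    (\<exists>\<phi>. interval_map (top_ob (sub_at H p)) (top_ob (sub_at K (F p))) \<phi> \<and>
      (\<forall>i\<le>top_ob (sub_at H p). F (p @ [i]) = F p @ [\<phi> i])))"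

lemma path_mapE:
  assumes "path_map H K F" "is_path H p"
  obtains \<phi> where "interval_map (top_ob (sub_at H p)) (top_ob (sub_at K (F p))) \<phi>"
    "\<And>i. i \<le> top_ob (sub_at H p) \<Longrightarrow> F (p @ [i]) = F p @ [\<phi> i]"
  using assms unfolding path_map_def by blast

lemma path_map_is_path:
  assumes "path_map H K F" "is_path H p"
  shows "is_path K (F p) \<and> length (F p) = length p"
  using assms(2)
proof (induction p rule: rev_induct)
  case Nil
  then show ?case using assms(1) by (simp add: path_map_def)
next
  case (snoc i p)
  then have p: "is_path H p" and i: "i \<le> top_ob (sub_at H p)"
    by (auto simp: is_path_append)
  from path_mapE[OF assms(1) p] obtain \<phi>
    where \<phi>: "interval_map (top_ob (sub_at H p)) (top_ob (sub_at K (F p))) \<phi>"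
      "\<And>i. i \<le> top_ob (sub_at H p) \<Longrightarrow> F (p @ [i]) = F p @ [\<phi> i]" by metis
  with snoc.IH p i show ?case by (auto simp: is_path_append interval_map_le)
qed

lemma path_map_mor_path:
  assumes "is_imor H K g"
  shows "path_map H K (mor_path g)"
  unfolding path_map_def
proof (intro conjI allI impI)
  fix p assume "is_path H p"
  from is_imor_mor_ob[OF is_imor_mor_at[OF assms this]]
  show "\<exists>\<phi>. interval_map (top_ob (sub_at H p)) (top_ob (sub_at K (mor_path g p))) \<phi> \<and>
      (\<forall>i\<le>top_ob (sub_at H p). mor_path g (p @ [i]) = mor_path g p @ [\<phi> i])"
    by (auto simp: mor_path_append)
qed simp

lemma is_imor_TrivialD: "is_imor H Trivial g \<Longrightarrow> g = ToTrivial"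
  by (auto elim: is_imor.cases)

text \<open>
  Faithfulness of the action on paths: paths of length one determine the object map, and the
  paths through \<open>i\<close> determine the component at \<open>i\<close> by induction. Besides giving faithfulness of
  the functor to disks, this reduces every equation between morphisms to one between actions.
\<close>

lemma is_imor_eqI:
  assumes "is_imor H K g" "is_imor H K g'"
    and "\<And>p. is_path H p \<Longrightarrow> mor_path g p = mor_path g' p"
  shows "g = g'"
  using assms
proof (induction arbitrary: g' rule: is_imor.induct)
  case (to_trivial H)
  then show ?case by (auto dest: is_imor_TrivialD)
next
  case (imor K gs H)
  from imor.prems(1) imor.hyps(1) obtain hs where g': "g' = IMor hs" and
    len: "length hs = Suc (top_ob H)"
    by (auto elim: is_imor.cases)
  have "gs ! i = hs ! i" if i: "i \<le> top_ob H" for i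
  proof (rule prod_eqI)
    show fst: "fst (gs ! i) = fst (hs ! i)"
      using imor.prems(2)[of "[i]"] i by (simp add: g')
    have "is_imor (sub H i) (sub K (fst (gs ! i))) (snd (hs ! i))"
      using is_imor_mor_sub[OF imor.prems(1) i] by (simp add: g' fst)
    moreover have "mor_path (snd (gs ! i)) p = mor_path (snd (hs ! i)) p"
      if "is_path (sub H i) p" for p
      using imor.prems(2)[of "i # p"] i that by (simp add: g')
    ultimately show "snd (gs ! i) = snd (hs ! i)"
      using imor.IH i by (simp add: Ob_def)
  qed
  then show ?case
    using imor.hyps(2) len by (simp add: g' list_eq_iff_nth_eq)
qed

lemma is_path_Trivial: "is_path Trivial p \<longleftrightarrow> p = replicate (length p) 0"
  by (induction p) auto

lemma mor_path_ToTrivial: "mor_path ToTrivial p = replicate (length p) 0"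
  by (induction p) auto

text \<open>
  As a map on paths sends extensions of a path to extensions of its image, the images of all paths
  through \<open>i\<close> begin with the same entry \<open>\<phi> i\<close>. Dropping it gives the component at \<open>i\<close>.
\<close>

lemma path_map_Cons:
  assumes F: "path_map H K F"
    and \<phi>: "\<And>i. i \<le> top_ob H \<Longrightarrow> F [i] = [\<phi> i]"
    and i: "i \<le> top_ob H"
  shows "is_path (sub H i) p \<Longrightarrow> F (i # p) = \<phi> i # tl (F (i # p))"
    and "path_map (sub H i) (sub K (\<phi> i)) (\<lambda>p. tl (F (i # p)))"
proof -
  show eq: "F (i # p) = \<phi> i # tl (F (i # p))" if "is_path (sub H i) p" for p
    using that
  proof (induction p rule: rev_induct)
    case Nil
    then show ?case using \<phi> i by simp
  next
    case (snoc j p)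
    then have "is_path H (i # p)" and "j \<le> top_ob (sub_at H (i # p))"
      and p: "is_path (sub H i) p"
      using i by (auto simp: is_path_append)
    then have "\<exists>k. F (i # p @ [j]) = F (i # p) @ [k]"
      using path_mapE[OF F] by (metis append_Cons)
    with snoc.IH[OF p] show ?case by (metis append_Cons list.sel(3))
  qed
  show "path_map (sub H i) (sub K (\<phi> i)) (\<lambda>p. tl (F (i # p)))"
    unfolding path_map_def
  proof (intro conjI allI impI)
    fix p assume p: "is_path (sub H i) p"
    then have "is_path H (i # p)" using i by simp
    from path_mapE[OF F this] obtain \<psi> where
      \<psi>: "interval_map (top_ob (sub_at H (i # p))) (top_ob (sub_at K (F (i # p)))) \<psi>"
      "\<And>j. j \<le> top_ob (sub_at H (i # p)) \<Longrightarrow> F ((i # p) @ [j]) = F (i # p) @ [\<psi> j]"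
      by metis
    have "sub_at K (F (i # p)) = sub_at (sub K (\<phi> i)) (tl (F (i # p)))"
      using eq[OF p] by (metis foldl_Cons)
    moreover have "tl (F (i # p @ [j])) = tl (F (i # p)) @ [\<psi> j]"
      if "j \<le> top_ob (sub_at (sub H i) p)" for j
      using \<psi>(2)[of j] eq[OF p] that
      by (metis append_Cons foldl_Cons list.sel(3))
    ultimately show "\<exists>\<psi>. interval_map (top_ob (sub_at (sub H i) p))
        (top_ob (sub_at (sub K (\<phi> i)) (tl (F (i # p))))) \<psi> \<and>
      (\<forall>j\<le>top_ob (sub_at (sub H i) p). tl (F (i # p @ [j])) = tl (F (i # p)) @ [\<psi> j])"
      using \<psi>(1) by auto
  qed (use \<phi> i in simp)
qed

text \<open>
  Fullness of the action on paths, by induction on the height of the codomain: the action on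
  paths of length one is the object map, and \<open>path_map_Cons\<close> supplies the components.
\<close>

lemma path_map_is_mor_path:
  assumes "\<exists>n. has_height n K" and "path_map H K F"
  shows "\<exists>g. is_imor H K g \<and> (\<forall>p. is_path H p \<longrightarrow> mor_path g p = F p)"
proof -
  have "has_height n K \<Longrightarrow> path_map H K F \<Longrightarrow> ?thesis" for n
  proof (induction arbitrary: H F rule: has_height.induct)
    case trivial
    then have "\<forall>p. is_path H p \<longrightarrow> mor_path ToTrivial p = F p"
      using path_map_is_path[OF trivial] by (metis is_path_Trivial mor_path_ToTrivial)
    then show ?case using is_imor.to_trivial by blast
  next
    case (node n Ks)
    let ?K = "Node Ks"
    have Nil: "is_path H []" and F_Nil: "F [] = []"
      using node.prems by (auto simp: path_map_def)
    from path_mapE[OF node.prems Nil] F_Nil obtain \<phi>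
      where \<phi>: "interval_map (top_ob H) (top_ob ?K) \<phi>"
        and F\<phi>: "\<And>i. i \<le> top_ob H \<Longrightarrow> F [i] = [\<phi> i]"
      by (metis append_Nil foldl_Nil)
    have "\<exists>g. is_imor (sub H i) (sub ?K (\<phi> i)) g \<and>
        (\<forall>p. is_path (sub H i) p \<longrightarrow> mor_path g p = tl (F (i # p)))"
      if i: "i \<le> top_ob H" for i
    proof -
      have "\<phi> i \<in> Ob ?K" using interval_map_le[OF \<phi> i] by (simp add: Ob_def)
      with node.IH path_map_Cons(2)[OF node.prems F\<phi> i] show ?thesis by blast
    qed
    then obtain g where g: "\<And>i. i \<le> top_ob H \<Longrightarrow> is_imor (sub H i) (sub ?K (\<phi> i)) (g i)"
      and g_path: "\<And>i p. i \<le> top_ob H \<Longrightarrow> is_path (sub H i) p \<Longrightarrow>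
        mor_path (g i) p = tl (F (i # p))"
      by metis
    let ?gs = "map (\<lambda>i. (\<phi> i, g i)) [0..<Suc (top_ob H)]"
    have nth: "?gs ! i = (\<phi> i, g i)" if "i \<le> top_ob H" for i
      using that by (simp del: upt_Suc)
    have "is_imor H ?K (IMor ?gs)"
    proof (rule is_imor.imor)
      show "interval_map (top_ob H) (top_ob ?K) (\<lambda>i. fst (?gs ! i))"
        using \<phi> nth interval_map_cong[of "top_ob H" "\<lambda>i. fst (?gs ! i)" \<phi>]
        by (simp del: upt_Suc)
      show "\<forall>i\<in>Ob H. is_imor (sub H i) (sub ?K (fst (?gs ! i))) (snd (?gs ! i))"
        using g nth by (simp add: Ob_def del: upt_Suc sub.simps)
    qed auto
    moreover have "mor_path (IMor ?gs) p = F p" if "is_path H p" for p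
    proof (cases p)
      case Nil
      then show ?thesis by (simp add: F_Nil)
    next
      case (Cons i q)
      with that have "i \<le> top_ob H" "is_path (sub H i) q" by auto
      with path_map_Cons(1)[OF node.prems F\<phi>] show ?thesis
        by (simp add: Cons nth g_path del: upt_Suc)
    qed
    ultimately show ?case by blast
  qed
  with assms show ?thesis by blast
qed

section \<open>The category of iterated intervals\<close>

lemma has_height_sub:
  assumes "\<exists>n. has_height n H" and "i \<le> top_ob H"
  shows "\<exists>n. has_height n (sub H i)"
proof -
  from assms(1) obtain n where "has_height n H" by blast
  then show ?thesis
    using assms(2) by cases (auto simp: Ob_def intro: has_height.trivial)
qed

lemma has_height_sub_at:
  "\<exists>n. has_height n H \<Longrightarrow> is_path H p \<Longrightarrow> \<exists>n. has_height n (sub_at H p)"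
proof (induction p arbitrary: H)
  case (Cons i p)
  have "\<exists>n. has_height n (sub H i)"
    using has_height_sub Cons.prems by simp
  from Cons.IH[OF this] Cons.prems show ?case by simp
qed simp

lemma top_ob_eq_0_iff: "\<exists>n. has_height n H \<Longrightarrow> top_ob H = 0 \<longleftrightarrow> H = Trivial"
  by (auto elim!: has_height.cases)

lemma sub_Trivial_iff:
  assumes "\<exists>n. has_height n H" and "i \<le> top_ob H"
  shows "sub H i = Trivial \<longleftrightarrow> i = 0 \<or> i = top_ob H"
proof -
  from assms(1) obtain n where "has_height n H" by blast
  then show ?thesis using assms(2) by cases (auto simp: Ob_def)
qed

lemma iid_props:
  assumes "has_height n H"
  shows "is_imor H H (iid H) \<and> (\<forall>p. is_path H p \<longrightarrow> mor_path (iid H) p = p)"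
  using assms
proof (induction rule: has_height.induct)
  case trivial
  then show ?case by (auto intro: is_imor.to_trivial simp: is_path_Trivial mor_path_ToTrivial)
next
  case (node n Hs)
  let ?gs = "zip [0..<length Hs] (map iid Hs)"
  have nth: "?gs ! i = (i, iid (Hs ! i))" if "i \<le> top_ob (Node Hs)" for i
    using that node.hyps(2) by simp
  have IH: "is_imor (Hs ! i) (Hs ! i) (iid (Hs ! i))"
    "is_path (Hs ! i) p \<Longrightarrow> mor_path (iid (Hs ! i)) p = p"
    if "i \<le> top_ob (Node Hs)" for i p
    using node.IH that by (auto simp: Ob_def)
  have "is_imor (Node Hs) (Node Hs) (IMor ?gs)"
  proof (rule is_imor.imor)
    show "interval_map (top_ob (Node Hs)) (top_ob (Node Hs)) (\<lambda>i. fst (?gs ! i))"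
      using interval_map_id interval_map_cong[of _ "\<lambda>i. fst (?gs ! i)" "\<lambda>i. i"] nth by simp
    show "\<forall>i\<in>Ob (Node Hs). is_imor (sub (Node Hs) i) (sub (Node Hs) (fst (?gs ! i))) (snd (?gs ! i))"
      using IH(1) nth by (simp add: Ob_def)
  qed (use node.hyps(2) in auto)
  moreover have "mor_path (IMor ?gs) p = p" if "is_path (Node Hs) p" for p
    using that IH(2) nth by (cases p) auto
  ultimately show ?case by simp
qed

lemma is_imor_iid: "\<exists>n. has_height n H \<Longrightarrow> is_imor H H (iid H)"
  and mor_path_iid: "\<exists>n. has_height n H \<Longrightarrow> is_path H p \<Longrightarrow> mor_path (iid H) p = p"
  using iid_props by blast+

text \<open>
  An interval map \<open>[0] \<rightarrow> [n]\<close> hits both endpoints, so \<open>n = 0\<close>, and only the trivial object has the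
  underlying interval \<open>[0]\<close>.
\<close>

lemma is_imor_from_Trivial:
  assumes "is_imor Trivial L g" and "\<exists>n. has_height n L"
  shows "L = Trivial"
  using is_imor_mor_ob[OF assms(1)] top_ob_eq_0_iff[OF assms(2)]
  by (simp add: interval_map_def)

text \<open>
  The defining formula of composition at a position \<open>i\<close>, now also valid if one of the factors is
  \<open>ToTrivial\<close>.
\<close>

lemma icomp_components:
  assumes f: "is_imor H K f" and g: "is_imor K L g" and L: "\<exists>n. has_height n L"
    and i: "i \<le> top_ob H"
  shows "mor_ob (icomp g f) i = mor_ob g (mor_ob f i)"
    and "mor_sub (icomp g f) i = icomp (mor_sub g (mor_ob f i)) (mor_sub f i)"
proof -
  have "g = ToTrivial" if "f = ToTrivial"
  proof -
    from f that have "K = Trivial" by (auto elim: is_imor.cases)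
    with g L show ?thesis by (metis is_imor_from_Trivial is_imor_TrivialD)
  qed
  moreover have "i < length fs" if "f = IMor fs" for fs
    using f i that by (auto elim: is_imor.cases)
  ultimately show "mor_ob (icomp g f) i = mor_ob g (mor_ob f i)"
    "mor_sub (icomp g f) i = icomp (mor_sub g (mor_ob f i)) (mor_sub f i)"
    by (cases f; cases g; auto simp: case_prod_beta)+
qed

lemma mor_path_icomp:
  assumes "is_imor H K f" "is_imor K L g" "\<exists>n. has_height n L" "is_path H p"
  shows "mor_path (icomp g f) p = mor_path g (mor_path f p)"
  using assms
proof (induction p arbitrary: H K L f g)
  case (Cons i p)
  then have i: "i \<le> top_ob H" by simp
  with Cons.prems(1) have j: "mor_ob f i \<le> top_ob K"
    using interval_map_le[OF is_imor_mor_ob] by blast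
  with Cons.prems(2) have l: "mor_ob g (mor_ob f i) \<le> top_ob L"
    using interval_map_le[OF is_imor_mor_ob] by blast
  have "mor_path (icomp (mor_sub g (mor_ob f i)) (mor_sub f i)) p =
    mor_path (mor_sub g (mor_ob f i)) (mor_path (mor_sub f i) p)"
    using Cons.IH[OF is_imor_mor_sub[OF Cons.prems(1) i] is_imor_mor_sub[OF Cons.prems(2) j]
      has_height_sub[OF Cons.prems(3) l]] Cons.prems(4) by simp
  then show ?case using icomp_components[OF Cons.prems(1-3) i] by simp
qed simp

lemma is_imor_icomp:
  assumes "is_imor H K f" "is_imor K L g" "\<exists>n. has_height n L"
  shows "is_imor H L (icomp g f)"
  using assms
proof (induction arbitrary: L g rule: is_imor.induct)
  case (to_trivial H)
  then show ?case
    by (metis icomp.simps(2) is_imor.to_trivial is_imor_TrivialD is_imor_from_Trivial)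
next
  case (imor K fs H)
  have f: "is_imor H K (IMor fs)"
    using imor by (intro is_imor.imor) auto
  show ?case
  proof (cases g)
    case ToTrivial
    with imor.prems have "L = Trivial" by (auto elim: is_imor.cases)
    then show ?thesis by (simp add: ToTrivial is_imor.to_trivial)
  next
    case (IMor gs)
    let ?h = "icomp g (IMor fs)"
    let ?hs = "map (\<lambda>(j, d). (fst (gs ! j), icomp (snd (gs ! j)) d)) fs"
    have h: "?h = IMor ?hs" by (simp add: IMor)
    have hs: "fst (?hs ! i) = mor_ob ?h i" "snd (?hs ! i) = mor_sub ?h i" for i
      by (simp_all add: h)
    note comp = icomp_components[OF f imor.prems]
    have "is_imor H L (IMor ?hs)"
    proof (rule is_imor.imor)
      show "L \<noteq> Trivial" using imor.prems(1) IMor by (auto dest: is_imor_TrivialD)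
      show "length ?hs = Suc (top_ob H)" using imor.hyps by simp
      show "interval_map (top_ob H) (top_ob L) (\<lambda>i. fst (?hs ! i))"
        using interval_map_comp[OF is_imor_mor_ob[OF f] is_imor_mor_ob[OF imor.prems(1)]] comp(1)
          interval_map_cong[of "top_ob H" "mor_ob ?h" "\<lambda>i. mor_ob g (mor_ob (IMor fs) i)"]
        unfolding hs by simp
      show "\<forall>i\<in>Ob H. is_imor (sub H i) (sub L (fst (?hs ! i))) (snd (?hs ! i))"
      proof
        fix i assume i: "i \<in> Ob H"
        then have i': "i \<le> top_ob H" by (simp add: Ob_def)
        let ?j = "mor_ob (IMor fs) i"
        have j: "?j \<le> top_ob K" and l: "mor_ob g ?j \<le> top_ob L"
          using interval_map_le[OF is_imor_mor_ob] f imor.prems(1) i' by blast+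
        show "is_imor (sub H i) (sub L (fst (?hs ! i))) (snd (?hs ! i))"
          using imor.IH[rule_format, OF i, THEN conjunct2, rule_format,
              OF is_imor_mor_sub[OF imor.prems(1) j, simplified] has_height_sub[OF imor.prems(2) l, simplified]]
          unfolding hs comp[OF i'] by simp
      qed
    qed
    then show ?thesis by (simp add: h)
  qed
qed

lemma iI_simps:
  "Obj iI = {H. (\<exists>n. has_height n H) \<and> H \<noteq> Trivial}" "Hom iI H K = {g. is_imor H K g}"
  "Ident iI = iid" "Comp iI H K L g f = icomp g f"
  by (auto simp: iI_def iI_plus_def full_subcategory_def)

text \<open>
  The unit and associativity laws are inherited from maps on paths, as morphisms act faithfully.
\<close>

lemma category_iI: "category iI"
proof
  fix X assume "X \<in> Obj iI"
  then show "Ident iI X \<in> Hom iI X X" using is_imor_iid by (auto simp: iI_simps)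
next
  fix X Y Z f g assume "X \<in> Obj iI" "Y \<in> Obj iI" "Z \<in> Obj iI" "f \<in> Hom iI X Y" "g \<in> Hom iI Y Z"
  then show "Comp iI X Y Z g f \<in> Hom iI X Z" by (auto simp: iI_simps intro: is_imor_icomp)
next
  fix X Y f assume "X \<in> Obj iI" "Y \<in> Obj iI" "f \<in> Hom iI X Y"
  then have X: "\<exists>n. has_height n X" and Y: "\<exists>n. has_height n Y" and f: "is_imor X Y f"
    by (auto simp: iI_simps)
  note idX = is_imor_iid[OF X] and idY = is_imor_iid[OF Y]
  show "Comp iI X X Y f (Ident iI X) = f"
    unfolding iI_simps using is_imor_icomp[OF idX f Y] f
    by (rule is_imor_eqI) (simp add: mor_path_icomp[OF idX f Y] mor_path_iid[OF X])
  show "Comp iI X Y Y (Ident iI Y) f = f"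
    unfolding iI_simps using is_imor_icomp[OF f idY Y] f
    by (rule is_imor_eqI)
      (simp add: mor_path_icomp[OF f idY Y] mor_path_iid[OF Y] path_map_is_path[OF path_map_mor_path[OF f]])
next
  fix W X Y Z f g h
  assume "W \<in> Obj iI" "X \<in> Obj iI" "Y \<in> Obj iI" "Z \<in> Obj iI"
    "f \<in> Hom iI W X" "g \<in> Hom iI X Y" "h \<in> Hom iI Y Z"
  then have ex: "\<exists>n. has_height n Y" "\<exists>n. has_height n Z"
    and f: "is_imor W X f" and g: "is_imor X Y g" and h: "is_imor Y Z h"
    by (auto simp: iI_simps)
  note gf = is_imor_icomp[OF f g ex(1)] and hg = is_imor_icomp[OF g h ex(2)]
  show "Comp iI W Y Z h (Comp iI W X Y g f) = Comp iI W X Z (Comp iI X Y Z h g) f"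
    unfolding iI_simps using is_imor_icomp[OF gf h ex(2)] is_imor_icomp[OF f hg ex(2)]
    by (rule is_imor_eqI)
      (simp add: mor_path_icomp[OF gf h ex(2)] mor_path_icomp[OF f hg ex(2)]
        mor_path_icomp[OF f g ex(1)] mor_path_icomp[OF g h ex(2)]
        path_map_is_path[OF path_map_mor_path[OF f]])
qed

section \<open>The category of disks\<close>

lemma disk_mor_fiber:
  assumes "is_disk_mor A B f" "y \<in> fiber A n x"
  shows "f (Suc n) y \<in> fiber B n (f n x)"
  using assms unfolding is_disk_mor_def fiber_def by (auto simp: PiE_iff)

lemma is_least_unique:
  "linear_order_on X r \<Longrightarrow> is_least X r x \<Longrightarrow> is_least X r y \<Longrightarrow> x = y"
  unfolding is_least_def linear_order_on_def partial_order_on_def antisym_def by blast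

lemma is_greatest_unique:
  "linear_order_on X r \<Longrightarrow> is_greatest X r x \<Longrightarrow> is_greatest X r y \<Longrightarrow> x = y"
  unfolding is_greatest_def linear_order_on_def partial_order_on_def antisym_def by blast

lemma disk_mor_lev: "is_disk_mor A B f \<Longrightarrow> x \<in> lev A n \<Longrightarrow> f n x \<in> lev B n"
  unfolding is_disk_mor_def by (auto simp: PiE_iff)

lemma is_tree_proj: "is_tree A \<Longrightarrow> y \<in> lev A (Suc n) \<Longrightarrow> proj A n y \<in> lev A n"
  unfolding is_tree_def by (auto simp: PiE_iff)

lemma Disk_simps:
  "Obj Disk = {A. is_disk A}" "Hom Disk A B = {f. is_disk_mor A B f}"
  "Ident Disk A = (\<lambda>n. \<lambda>x\<in>lev A n. x)"
  "Comp Disk A B C g f = (\<lambda>n. compose (lev A n) (g n) (f n))"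
  by (simp_all add: Disk_def)

lemma disk_mor_id:
  assumes "is_tree A"
  shows "is_disk_mor A A (\<lambda>n. \<lambda>x\<in>lev A n. x)"
  using is_tree_proj[OF assms]
  unfolding is_disk_mor_def by (auto simp: fiber_def is_least_def is_greatest_def)

lemma disk_mor_comp:
  assumes A: "is_tree A" and f: "is_disk_mor A B f" and g: "is_disk_mor B C g"
  shows "is_disk_mor A C (\<lambda>n. compose (lev A n) (g n) (f n))"
  unfolding is_disk_mor_def
proof (intro conjI allI ballI impI)
  fix n
  show "compose (lev A n) (g n) (f n) \<in> lev A n \<rightarrow>\<^sub>E lev C n"
    using disk_mor_lev[OF f] disk_mor_lev[OF g] by (auto simp: compose_def)
next
  fix n y assume y: "y \<in> lev A (Suc n)"
  then show "proj C n (compose (lev A (Suc n)) (g (Suc n)) (f (Suc n)) y) =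
      compose (lev A n) (g n) (f n) (proj A n y)"
    using f g disk_mor_lev[OF f y] is_tree_proj[OF A y]
    by (simp add: compose_def is_disk_mor_def)
next
  fix n x y z
  assume x: "x \<in> lev A n" and yz: "y \<in> fiber A n x" "z \<in> fiber A n x" "(y, z) \<in> ford A n x"
  have "(f (Suc n) y, f (Suc n) z) \<in> ford B n (f n x)"
    using f x yz by (simp add: is_disk_mor_def)
  then have "(g (Suc n) (f (Suc n) y), g (Suc n) (f (Suc n) z)) \<in> ford C n (g n (f n x))"
    using g disk_mor_lev[OF f x] disk_mor_fiber[OF f] yz by (simp add: is_disk_mor_def)
  then show "(compose (lev A (Suc n)) (g (Suc n)) (f (Suc n)) y,
      compose (lev A (Suc n)) (g (Suc n)) (f (Suc n)) z)
    \<in> ford C n (compose (lev A n) (g n) (f n) x)"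
    using x yz by (simp add: compose_def fiber_def)
next
  fix n x y
  assume x: "x \<in> lev A n" and y: "is_least (fiber A n x) (ford A n x) y"
  then have "is_least (fiber B n (f n x)) (ford B n (f n x)) (f (Suc n) y)"
    using f by (simp add: is_disk_mor_def)
  then have "is_least (fiber C n (g n (f n x))) (ford C n (g n (f n x))) (g (Suc n) (f (Suc n) y))"
    using g disk_mor_lev[OF f x] by (simp add: is_disk_mor_def)
  moreover have "y \<in> lev A (Suc n)" using y by (simp add: is_least_def fiber_def)
  ultimately show "is_least (fiber C n (compose (lev A n) (g n) (f n) x))
      (ford C n (compose (lev A n) (g n) (f n) x))
      (compose (lev A (Suc n)) (g (Suc n)) (f (Suc n)) y)"
    using x by (simp add: compose_def)
next
  fix n x y
  assume x: "x \<in> lev A n" and y: "is_greatest (fiber A n x) (ford A n x) y"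
  then have "is_greatest (fiber B n (f n x)) (ford B n (f n x)) (f (Suc n) y)"
    using f by (simp add: is_disk_mor_def)
  then have "is_greatest (fiber C n (g n (f n x))) (ford C n (g n (f n x)))
      (g (Suc n) (f (Suc n) y))"
    using g disk_mor_lev[OF f x] by (simp add: is_disk_mor_def)
  moreover have "y \<in> lev A (Suc n)" using y by (simp add: is_greatest_def fiber_def)
  ultimately show "is_greatest (fiber C n (compose (lev A n) (g n) (f n) x))
      (ford C n (compose (lev A n) (g n) (f n) x))
      (compose (lev A (Suc n)) (g (Suc n)) (f (Suc n)) y)"
    using x by (simp add: compose_def)
qed

lemma disk_mor_ext:
  assumes "is_disk_mor A B f" "is_disk_mor A B g"
    and "\<And>n x. x \<in> lev A n \<Longrightarrow> f n x = g n x"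
  shows "f = g"
proof
  fix n
  have "f n \<in> lev A n \<rightarrow>\<^sub>E lev B n" "g n \<in> lev A n \<rightarrow>\<^sub>E lev B n"
    using assms(1,2) by (simp_all add: is_disk_mor_def)
  then show "f n = g n" using assms(3) by (rule PiE_ext)
qed

lemma category_Disk: "category Disk"
proof
  fix A :: "'a disk" assume "A \<in> Obj Disk"
  then show "Ident Disk A \<in> Hom Disk A A"
    unfolding Disk_simps by (auto simp: is_disk_def intro: disk_mor_id)
next
  fix A B C :: "'a disk" and f g
  assume "A \<in> Obj Disk" "B \<in> Obj Disk" "C \<in> Obj Disk" "f \<in> Hom Disk A B" "g \<in> Hom Disk B C"
  then show "Comp Disk A B C g f \<in> Hom Disk A C"
    unfolding Disk_simps by (auto simp: is_disk_def intro: disk_mor_comp)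
next
  fix A B :: "'a disk" and f
  assume "f \<in> Hom Disk A B"
  then have f: "f n \<in> lev A n \<rightarrow>\<^sub>E lev B n" for n
    by (simp add: Disk_simps is_disk_mor_def)
  show "Comp Disk A A B f (Ident Disk A) = f"
  proof
    fix n show "Comp Disk A A B f (Ident Disk A) n = f n"
      using f[of n] by (auto simp: Disk_simps compose_def PiE_iff extensional_def)
  qed
  show "Comp Disk A B B (Ident Disk B) f = f"
  proof (intro ext)
    fix n x show "Comp Disk A B B (Ident Disk B) f n x = f n x"
      using f[of n] by (cases "x \<in> lev A n") (auto simp: Disk_simps compose_def)
  qed
next
  fix A B C E :: "'a disk" and f g h
  assume f: "f \<in> Hom Disk A B"
  show "Comp Disk A C E h (Comp Disk A B C g f) = Comp Disk A B E (Comp Disk B C E h g) f"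
  proof
    fix n show "Comp Disk A C E h (Comp Disk A B C g f) n = Comp Disk A B E (Comp Disk B C E h g) f n"
      using f disk_mor_lev by (fastforce simp: Disk_simps compose_def)
  qed
qed

text \<open>
  The levelwise inverses form a morphism: they commute with the projections because \<open>f\<close> does and
  is injective, and they preserve order because the fibers of \<open>A\<close> are totally ordered, so that a
  pair put in the wrong order would, by antisymmetry in \<open>B\<close>, have equal images under \<open>f\<close>. Least
  and greatest elements are then preserved, since fibers are mapped onto fibers.
\<close>

lemma disk_iso_if_bij:
  assumes A: "is_disk A" and B: "is_disk B" and f: "is_disk_mor A B f"
    and bij: "\<And>n. bij_betw (f n) (lev A n) (lev B n)"
  shows "\<exists>g. is_iso Disk B A g"
proof -
  define g where "g n = (\<lambda>y\<in>lev B n. inv_into (lev A n) (f n) y)" for n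
  have treeA: "is_tree A" and treeB: "is_tree B" using A B by (auto simp: is_disk_def)
  have g_in: "g n y \<in> lev A n" and fg: "f n (g n y) = y" if "y \<in> lev B n" for n y
    using bij_betw_inv_into_right[OF bij that] bij_betwE[OF bij_betw_inv_into[OF bij]] that by (auto simp: g_def)
  have gf: "g n (f n x) = x" if "x \<in> lev A n" for n x
    using bij_betw_inv_into_left[OF bij that] disk_mor_lev[OF f that] by (simp add: g_def)
  have g_proj: "proj A n (g (Suc n) y) = g n (proj B n y)" if y: "y \<in> lev B (Suc n)" for n y
  proof -
    have "f n (proj A n (g (Suc n) y)) = proj B n y"
      using f g_in[OF y] fg[OF y] unfolding is_disk_mor_def by metis
    with gf[OF is_tree_proj[OF treeA g_in[OF y]]] show ?thesis by simp
  qed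
  then have g_fiber: "g (Suc n) y \<in> fiber A n (g n x)" if "y \<in> fiber B n x" for n x y
    using that g_in[of y "Suc n"] by (auto simp: fiber_def)
  have lin: "linear_order_on (fiber A n x) (ford A n x)" if "x \<in> lev A n" for n x
    using A that by (simp add: is_disk_def interval_structure_def)
  have linB: "linear_order_on (fiber B n x) (ford B n x)" if "x \<in> lev B n" for n x
    using B that by (simp add: is_disk_def interval_structure_def)
  have g_ford: "(g (Suc n) y, g (Suc n) z) \<in> ford A n (g n x)"
    if x: "x \<in> lev B n" and yz: "y \<in> fiber B n x" "z \<in> fiber B n x" "(y, z) \<in> ford B n x"
    for n x y z
  proof (rule ccontr)
    let ?y = "g (Suc n) y" and ?z = "g (Suc n) z"
    have yz': "?y \<in> fiber A n (g n x)" "?z \<in> fiber A n (g n x)"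
      using yz g_fiber by blast+
    assume "(?y, ?z) \<notin> ford A n (g n x)"
    then have "(?z, ?y) \<in> ford A n (g n x)" and "?y \<noteq> ?z"
      using lin[OF g_in[OF x]] yz'
      unfolding linear_order_on_def total_on_def partial_order_on_def preorder_on_def refl_on_def
      by metis+
    then have "(f (Suc n) ?z, f (Suc n) ?y) \<in> ford B n (f n (g n x))"
      using f g_in[OF x] yz' unfolding is_disk_mor_def by blast
    then have "(z, y) \<in> ford B n x"
      using yz x fg by (simp add: fiber_def)
    with yz(3) linB[OF x] have "y = z"
      unfolding linear_order_on_def partial_order_on_def antisym_def by blast
    with \<open>?y \<noteq> ?z\<close> show False by simp
  qed
  have f_fiber: "f (Suc n) z \<in> fiber B n x" and gf_fiber: "g (Suc n) (f (Suc n) z) = z"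
    if "x \<in> lev B n" "z \<in> fiber A n (g n x)" for n x z
    using disk_mor_fiber[OF f that(2)] that fg[OF that(1)] gf[of z "Suc n"]
    by (simp_all add: fiber_def)
  have g: "is_disk_mor B A g"
    unfolding is_disk_mor_def
  proof (intro conjI allI ballI impI)
    fix n x y assume x: "x \<in> lev B n" and y: "is_least (fiber B n x) (ford B n x) y"
    then show "is_least (fiber A n (g n x)) (ford A n (g n x)) (g (Suc n) y)"
      using g_fiber g_ford[OF x, of y] f_fiber[OF x] gf_fiber[OF x] unfolding is_least_def by metis
  next
    fix n x y assume x: "x \<in> lev B n" and y: "is_greatest (fiber B n x) (ford B n x) y"
    then show "is_greatest (fiber A n (g n x)) (ford A n (g n x)) (g (Suc n) y)"
      using g_fiber g_ford[OF x, of _ y] f_fiber[OF x] gf_fiber[OF x] unfolding is_greatest_def by metis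
  qed (use g_in g_proj g_ford in \<open>auto simp: g_def\<close>)
  have "(\<lambda>n. compose (lev B n) (f n) (g n)) = (\<lambda>n. \<lambda>y\<in>lev B n. y)"
    using fg by (auto simp: compose_def fun_eq_iff restrict_def)
  moreover have "(\<lambda>n. compose (lev A n) (g n) (f n)) = (\<lambda>n. \<lambda>x\<in>lev A n. x)"
    using gf by (auto simp: compose_def fun_eq_iff restrict_def)
  ultimately show ?thesis
    using f g unfolding is_iso_def Disk_simps by blast
qed

section \<open>The disk of paths\<close>

text \<open>
  Paths are transported to the carrier type along an injection, so that they can be the elements
  of a disk over an arbitrary infinite type.
\<close>

locale path_coding =
  fixes code :: "nat list \<Rightarrow> 'a"
  assumes inj_code: "inj code"
begin

abbreviation decode :: "'a \<Rightarrow> nat list" where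
  "decode \<equiv> inv code"

lemma decode_code [simp]: "decode (code p) = p"
  by (simp add: inj_code)

lemma code_eq_iff [simp]: "code p = code q \<longleftrightarrow> p = q"
  by (simp add: inj_code inj_eq)

text \<open>
  The fibers are the underlying intervals of the constituents of \<open>H\<close>: the one over \<open>p\<close> is a copy of
  \<open>Ob (sub_at H p)\<close>, whose elements are the possible last entries after \<open>p\<close>.
\<close>

definition path_disk :: "iobj \<Rightarrow> 'a disk" where
  "path_disk H = \<lparr>lev = (\<lambda>n. code ` {p. is_path H p \<and> length p = n}),
    proj = (\<lambda>n. \<lambda>x\<in>code ` {p. is_path H p \<and> length p = Suc n}. code (butlast (decode x))),
    ford = (\<lambda>n x. {(code (p @ [i]), code (p @ [j])) | p i j.
      is_path H p \<and> length p = n \<and> code p = x \<and> i \<le> j \<and> j \<le> top_ob (sub_at H p)})\<rparr>"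

lemma lev_path_disk: "lev (path_disk H) n = code ` {p. is_path H p \<and> length p = n}"
  by (simp add: path_disk_def)

lemma code_in_lev [simp]: "code p \<in> lev (path_disk H) n \<longleftrightarrow> is_path H p \<and> length p = n"
  by (auto simp: lev_path_disk)

lemma proj_path_disk [simp]:
  "is_path H (p @ [i]) \<Longrightarrow> length p = n \<Longrightarrow> proj (path_disk H) n (code (p @ [i])) = code p"
  by (auto simp: path_disk_def)

lemma lev_SucE:
  assumes "y \<in> lev (path_disk H) (Suc n)"
  obtains p i where "y = code (p @ [i])" "is_path H p" "length p = n" "i \<le> top_ob (sub_at H p)"
  using assms by (auto simp: lev_path_disk elim: path_SucE)

lemma fiber_path_disk:
  assumes "is_path H p" "length p = n"
  shows "fiber (path_disk H) n (code p) = (\<lambda>i. code (p @ [i])) ` {0..top_ob (sub_at H p)}"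
  using assms by (auto simp: fiber_def is_path_append elim!: lev_SucE)

lemma ford_path_disk:
  assumes "is_path H p" "length p = n"
  shows "(code (p @ [i]), code (p @ [j])) \<in> ford (path_disk H) n (code p) \<longleftrightarrow>
    i \<le> j \<and> j \<le> top_ob (sub_at H p)"
  using assms by (auto simp: path_disk_def)

lemma is_least_path_disk:
  assumes "is_path H p" "length p = n"
  shows "is_least (fiber (path_disk H) n (code p)) (ford (path_disk H) n (code p)) y \<longleftrightarrow>
    y = code (p @ [0])"
proof
  assume y: "is_least (fiber (path_disk H) n (code p)) (ford (path_disk H) n (code p)) y"
  then obtain i where i: "y = code (p @ [i])"
    using assms by (auto simp: is_least_def fiber_path_disk)
  moreover have "code (p @ [0]) \<in> fiber (path_disk H) n (code p)"
    using assms by (auto simp: fiber_path_disk)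
  ultimately have "(code (p @ [i]), code (p @ [0])) \<in> ford (path_disk H) n (code p)"
    using y by (auto simp: is_least_def)
  with i show "y = code (p @ [0])"
    using assms by (simp add: ford_path_disk)
qed (use assms in \<open>auto simp: is_least_def fiber_path_disk ford_path_disk\<close>)

lemma is_greatest_path_disk:
  assumes "is_path H p" "length p = n"
  shows "is_greatest (fiber (path_disk H) n (code p)) (ford (path_disk H) n (code p)) y \<longleftrightarrow>
    y = code (p @ [top_ob (sub_at H p)])"
proof
  assume y: "is_greatest (fiber (path_disk H) n (code p)) (ford (path_disk H) n (code p)) y"
  then obtain i where i: "y = code (p @ [i])" "i \<le> top_ob (sub_at H p)"
    using assms by (auto simp: is_greatest_def fiber_path_disk)
  moreover have "code (p @ [top_ob (sub_at H p)]) \<in> fiber (path_disk H) n (code p)"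
    using assms by (auto simp: fiber_path_disk)
  ultimately have "(code (p @ [top_ob (sub_at H p)]), code (p @ [i])) \<in> ford (path_disk H) n (code p)"
    using y by (auto simp: is_greatest_def)
  with i show "y = code (p @ [top_ob (sub_at H p)])"
    using assms by (simp add: ford_path_disk)
qed (use assms in \<open>auto simp: is_greatest_def fiber_path_disk ford_path_disk\<close>)

lemma interval_structure_path_disk:
  assumes p: "is_path H p" "length p = n"
  shows "interval_structure (fiber (path_disk H) n (code p)) (ford (path_disk H) n (code p))"
proof -
  let ?X = "fiber (path_disk H) n (code p)" and ?r = "ford (path_disk H) n (code p)"
  let ?t = "top_ob (sub_at H p)" and ?\<phi> = "\<lambda>y. last (decode y)"
  have r: "?r = {(code (p @ [i]), code (p @ [j])) | i j. i \<le> j \<and> j \<le> ?t}"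
    using p by (auto simp: path_disk_def)
  have "linear_order_on ?X ?r"
    unfolding linear_order_on_def partial_order_on_def preorder_on_def
      refl_on_def trans_def antisym_def total_on_def fiber_path_disk[OF p] r by auto
  moreover have "bij_betw ?\<phi> ?X {0..?t}"
    unfolding fiber_path_disk[OF p] by (auto simp: bij_betw_def inj_on_def image_image)
  moreover have "\<forall>x\<in>?X. \<forall>y\<in>?X. (x, y) \<in> ?r \<longleftrightarrow> ?\<phi> x \<le> ?\<phi> y"
    using p by (auto simp: fiber_path_disk ford_path_disk)
  ultimately show ?thesis unfolding interval_structure_def by blast
qed

text \<open>
  Each step of a path strictly lowers the height until it is \<open>0\<close>, so after \<open>n\<close> steps only \<open>[0]\<close> is
  left. This is why disks of paths have finite degree.
\<close>

lemma path_bound: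
  assumes "has_height n H" "is_path H p" "n \<le> length p"
  shows "sub_at H p = Trivial"
  using assms
proof (induction arbitrary: p rule: has_height.induct)
  case trivial
  have "sub_at Trivial p = Trivial" for p by (induction p) auto
  then show ?case .
next
  case (node n Hs)
  then obtain i q where p: "p = i # q" by (cases p) auto
  with node.prems have i: "i \<in> Ob (Node Hs)" by (simp add: Ob_def)
  with node.IH obtain k where k: "k < n"
    "\<And>q. is_path (sub (Node Hs) i) q \<Longrightarrow> k \<le> length q \<Longrightarrow> sub_at (sub (Node Hs) i) q = Trivial"
    by blast
  from k(2)[of q] k(1) node.prems p show ?case by simp
qed

lemma proj_comp_path_disk:
  "is_path H p \<Longrightarrow> length p = n + m \<Longrightarrow> proj_comp (path_disk H) n m (code p) = code (take n p)"
proof (induction m arbitrary: p)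
  case (Suc m)
  then obtain q i where q: "p = q @ [i]" "is_path H q" "length q = n + m"
    by (metis add_Suc_right path_SucE)
  with Suc show ?case by simp
qed simp

lemma finite_degree_path_disk:
  assumes "has_height N H"
  shows "finite_degree (path_disk H)"
proof -
  have "bij_betw (proj_comp (path_disk H) N m) (lev (path_disk H) (N + m)) (lev (path_disk H) N)"
    for m
  proof -
    \<comment> \<open>from level \<open>N\<close> on all fibers are singletons, so a path can only continue by zeros\<close>
    have split: "q = take N q @ replicate m 0"
      if q: "is_path H q" "length q = N + m" for q
    proof -
      have "is_path H (take N q @ drop N q)" using q by simp
      then have "is_path H (take N q)" "is_path (sub_at H (take N q)) (drop N q)"
        unfolding is_path_append by auto
      with path_bound[OF assms this(1)] q have "drop N q = replicate m 0"
        by (simp add: is_path_Trivial)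
      then show ?thesis by (metis append_take_drop_id)
    qed
    have take: "is_path H (take N q)" if "is_path H q" for q
      using that is_path_append[of H "take N q" "drop N q"] by simp
    show ?thesis
    proof (rule bij_betwI')
      fix x y assume "x \<in> lev (path_disk H) (N + m)" "y \<in> lev (path_disk H) (N + m)"
      then show "proj_comp (path_disk H) N m x = proj_comp (path_disk H) N m y \<longleftrightarrow> x = y"
        using split by (auto simp: lev_path_disk proj_comp_path_disk) metis
    next
      fix x assume "x \<in> lev (path_disk H) (N + m)"
      then show "proj_comp (path_disk H) N m x \<in> lev (path_disk H) N"
        using take by (auto simp: lev_path_disk proj_comp_path_disk)
    next
      fix y assume "y \<in> lev (path_disk H) N"
      then obtain p where p: "y = code p" "is_path H p" "length p = N"
        by (auto simp: lev_path_disk)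
      with path_bound[OF assms] have "is_path H (p @ replicate m 0)"
        by (simp add: is_path_append is_path_Trivial)
      with p show "\<exists>x\<in>lev (path_disk H) (N + m). y = proj_comp (path_disk H) N m x"
        by (intro bexI[of _ "code (p @ replicate m 0)"]) (simp_all add: proj_comp_path_disk)
    qed
  qed
  then show ?thesis unfolding finite_degree_def has_degree_def by blast
qed

text \<open>
  The condition on the sections \<open>d\<^sub>0\<close>, \<open>d\<^sub>1\<close> says that the fiber over \<open>p @ [i]\<close> is a singleton
  exactly if \<open>i\<close> is an endpoint of the fiber over \<open>p\<close>. This is the requirement on objects of
  \<open>iI\<close> that \<open>H(i)\<close> is trivial if and only if \<open>i\<close> is an endpoint, applied to \<open>sub_at H p\<close>; if
  \<open>sub_at H p\<close> is itself trivial, both sides hold.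
\<close>

lemma is_disk_path_disk:
  assumes H: "\<exists>n. has_height n H" and "H \<noteq> Trivial"
  shows "is_disk (path_disk H)"
proof -
  let ?A = "path_disk H"
  let ?d\<^sub>0 = "\<lambda>(n::nat) x. code (decode x @ [0])"
  let ?d\<^sub>1 = "\<lambda>(n::nat) x. code (decode x @ [top_ob (sub_at H (decode x))])"
  have "lev ?A 0 = {code []}" by (auto simp: lev_path_disk)
  moreover have "proj ?A n \<in> lev ?A (Suc n) \<rightarrow>\<^sub>E lev ?A n" for n
  proof (rule PiE_I)
    fix x assume "x \<in> lev ?A (Suc n)"
    then show "proj ?A n x \<in> lev ?A n" by (auto simp: is_path_append elim!: lev_SucE)
  qed (simp add: path_disk_def)
  ultimately have tree: "is_tree ?A" by (simp add: is_tree_def)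
  have degree: "finite_degree ?A" using H finite_degree_path_disk by blast
  have fibers: "\<forall>n. \<forall>x\<in>lev ?A n. interval_structure (fiber ?A n x) (ford ?A n x)"
    using interval_structure_path_disk by (auto simp: lev_path_disk)
  have off: "\<forall>n x. x \<notin> lev ?A n \<longrightarrow> ford ?A n x = {}"
    by (auto simp: path_disk_def)
  have ends: "\<forall>n. \<forall>x\<in>lev ?A n. is_least (fiber ?A n x) (ford ?A n x) (?d\<^sub>0 n x) \<and>
      is_greatest (fiber ?A n x) (ford ?A n x) (?d\<^sub>1 n x)"
    by (auto simp: lev_path_disk is_least_path_disk is_greatest_path_disk)
  have root: "{x \<in> lev ?A 0. ?d\<^sub>0 0 x = ?d\<^sub>1 0 x} = {}"
    using top_ob_eq_0_iff[OF H] \<open>H \<noteq> Trivial\<close> by (auto simp: lev_path_disk)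
  have levels: "{x \<in> lev ?A (Suc n). ?d\<^sub>0 (Suc n) x = ?d\<^sub>1 (Suc n) x} =
      ?d\<^sub>0 n ` lev ?A n \<union> ?d\<^sub>1 n ` lev ?A n" for n
  proof -
    have end_iff: "top_ob (sub (sub_at H p) i) = 0 \<longleftrightarrow> i = 0 \<or> i = top_ob (sub_at H p)"
      if "is_path H p" "i \<le> top_ob (sub_at H p)" for p i
      using has_height_sub_at[OF H that(1)] that(2)
      by (simp add: top_ob_eq_0_iff has_height_sub sub_Trivial_iff)
    show ?thesis
    proof (intro equalityI subsetI)
      fix x assume "x \<in> {x \<in> lev ?A (Suc n). ?d\<^sub>0 (Suc n) x = ?d\<^sub>1 (Suc n) x}"
      then obtain p i where p: "x = code (p @ [i])" "is_path H p" "length p = n"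
        "i \<le> top_ob (sub_at H p)" "top_ob (sub (sub_at H p) i) = 0"
        by (auto elim!: lev_SucE)
      with end_iff have "x = ?d\<^sub>0 n (code p) \<or> x = ?d\<^sub>1 n (code p)" by auto
      moreover have "code p \<in> lev ?A n" using p by simp
      ultimately show "x \<in> ?d\<^sub>0 n ` lev ?A n \<union> ?d\<^sub>1 n ` lev ?A n" by blast
    next
      fix x assume "x \<in> ?d\<^sub>0 n ` lev ?A n \<union> ?d\<^sub>1 n ` lev ?A n"
      then obtain p where p: "is_path H p" "length p = n"
        and "x = code (p @ [0]) \<or> x = code (p @ [top_ob (sub_at H p)])"
        by (auto simp: lev_path_disk)
      then obtain i where x: "x = code (p @ [i])" and i: "i = 0 \<or> i = top_ob (sub_at H p)"
        by blast
      with p end_iff have "top_ob (sub (sub_at H p) i) = 0" by auto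
      with p x i show "x \<in> {x \<in> lev ?A (Suc n). ?d\<^sub>0 (Suc n) x = ?d\<^sub>1 (Suc n) x}"
        by (auto simp: is_path_append)
    qed
  qed
  show ?thesis
    unfolding is_disk_def
    using tree degree fibers off ends root levels by (intro conjI exI[of _ ?d\<^sub>0] exI[of _ ?d\<^sub>1]) simp_all
qed

definition path_disk_mor :: "iobj \<Rightarrow> (nat list \<Rightarrow> nat list) \<Rightarrow> nat \<Rightarrow> 'a \<Rightarrow> 'a" where
  "path_disk_mor H F n = (\<lambda>x\<in>lev (path_disk H) n. code (F (decode x)))"

lemma path_disk_mor_code:
  "is_path H p \<Longrightarrow> length p = n \<Longrightarrow> path_disk_mor H F n (code p) = code (F p)"
  by (simp add: path_disk_mor_def)

lemma is_disk_mor_path_disk_mor: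
  assumes F: "path_map H K F"
  shows "is_disk_mor (path_disk H) (path_disk K) (path_disk_mor H F)"
  unfolding is_disk_mor_def
proof (intro conjI allI ballI impI)
  fix n
  show "path_disk_mor H F n \<in> lev (path_disk H) n \<rightarrow>\<^sub>E lev (path_disk K) n"
    using path_map_is_path[OF F] by (auto simp: path_disk_mor_def lev_path_disk)
next
  fix n y assume "y \<in> lev (path_disk H) (Suc n)"
  then obtain p i where y: "y = code (p @ [i])" and p: "is_path H p" "length p = n"
    and i: "i \<le> top_ob (sub_at H p)" by (rule lev_SucE)
  then have pi: "is_path H (p @ [i])" by (simp add: is_path_append)
  from path_mapE[OF F p(1)] i obtain k where k: "F (p @ [i]) = F p @ [k]" by metis
  with p pi path_map_is_path[OF F pi] path_map_is_path[OF F p(1)]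
  show "proj (path_disk K) n (path_disk_mor H F (Suc n) y) =
      path_disk_mor H F n (proj (path_disk H) n y)"
    by (simp add: y path_disk_mor_code)
next
  fix n x y z
  assume x: "x \<in> lev (path_disk H) n" and y: "y \<in> fiber (path_disk H) n x"
    and z: "z \<in> fiber (path_disk H) n x" and yz: "(y, z) \<in> ford (path_disk H) n x"
  from x obtain p where p: "x = code p" "is_path H p" "length p = n" by (auto simp: lev_path_disk)
  with y z yz obtain i j where ij: "y = code (p @ [i])" "z = code (p @ [j])" "i \<le> j"
    "j \<le> top_ob (sub_at H p)"
    by (auto simp: fiber_path_disk ford_path_disk)
  from path_mapE[OF F p(2)] obtain \<phi>
    where \<phi>: "interval_map (top_ob (sub_at H p)) (top_ob (sub_at K (F p))) \<phi>"
      "\<And>i. i \<le> top_ob (sub_at H p) \<Longrightarrow> F (p @ [i]) = F p @ [\<phi> i]" by metis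
  from \<phi>(1) ij have "\<phi> i \<le> \<phi> j" "\<phi> j \<le> top_ob (sub_at K (F p))"
    by (auto simp: interval_map_le interval_map_def mono_on_def)
  then show "(path_disk_mor H F (Suc n) y, path_disk_mor H F (Suc n) z)
      \<in> ford (path_disk K) n (path_disk_mor H F n x)"
    using p ij \<phi>(2) path_map_is_path[OF F p(2)]
    by (simp add: path_disk_mor_code is_path_append ford_path_disk)
next
  fix n x y
  assume x: "x \<in> lev (path_disk H) n"
    and y: "is_least (fiber (path_disk H) n x) (ford (path_disk H) n x) y"
  from x obtain p where p: "x = code p" "is_path H p" "length p = n" by (auto simp: lev_path_disk)
  with y have y: "y = code (p @ [0])" by (simp add: is_least_path_disk)
  from path_mapE[OF F p(2)] obtain \<phi>
    where "interval_map (top_ob (sub_at H p)) (top_ob (sub_at K (F p))) \<phi>"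
      "\<And>i. i \<le> top_ob (sub_at H p) \<Longrightarrow> F (p @ [i]) = F p @ [\<phi> i]" by metis
  then have "F (p @ [0]) = F p @ [0]" by (simp add: interval_map_def)
  then show "is_least (fiber (path_disk K) n (path_disk_mor H F n x))
      (ford (path_disk K) n (path_disk_mor H F n x)) (path_disk_mor H F (Suc n) y)"
    using p y path_map_is_path[OF F p(2)]
    by (simp add: path_disk_mor_code is_path_append is_least_path_disk)
next
  fix n x y
  assume x: "x \<in> lev (path_disk H) n"
    and y: "is_greatest (fiber (path_disk H) n x) (ford (path_disk H) n x) y"
  from x obtain p where p: "x = code p" "is_path H p" "length p = n" by (auto simp: lev_path_disk)
  with y have y: "y = code (p @ [top_ob (sub_at H p)])" by (simp add: is_greatest_path_disk)
  from path_mapE[OF F p(2)] obtain \<phi>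
    where "interval_map (top_ob (sub_at H p)) (top_ob (sub_at K (F p))) \<phi>"
      "\<And>i. i \<le> top_ob (sub_at H p) \<Longrightarrow> F (p @ [i]) = F p @ [\<phi> i]" by metis
  then have "F (p @ [top_ob (sub_at H p)]) = F p @ [top_ob (sub_at K (F p))]"
    by (simp add: interval_map_def)
  then show "is_greatest (fiber (path_disk K) n (path_disk_mor H F n x))
      (ford (path_disk K) n (path_disk_mor H F n x)) (path_disk_mor H F (Suc n) y)"
    using p y path_map_is_path[OF F p(2)]
    by (simp add: path_disk_mor_code is_path_append is_greatest_path_disk)
qed

text \<open>
  The fiber over \<open>p\<close> is mapped into the fiber over \<open>F p\<close>, so \<open>F (p @ [i])\<close> extends \<open>F p\<close> by one
  entry; as a function of \<open>i\<close> this entry is monotone and preserves endpoints.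
\<close>

lemma disk_mor_is_path_disk_mor:
  assumes f: "is_disk_mor (path_disk H) (path_disk K) f"
  shows "\<exists>F. path_map H K F \<and> path_disk_mor H F = f"
proof -
  define F where "F p = decode (f (length p) (code p))" for p
  have code_F: "code (F p) = f (length p) (code p)"
    and F_path: "is_path K (F p)" "length (F p) = length p"
    if "is_path H p" for p
  proof -
    have "f (length p) (code p) \<in> lev (path_disk K) (length p)"
      using disk_mor_lev[OF f] that by simp
    then show "code (F p) = f (length p) (code p)" "is_path K (F p)" "length (F p) = length p"
      by (auto simp: lev_path_disk F_def)
  qed
  have "path_map H K F"
    unfolding path_map_def
  proof (intro conjI allI impI)
    show "F [] = []" using F_path(2)[of "[]"] by simp
  next
    fix p assume p: "is_path H p"
    let ?n = "length p" and ?t = "top_ob (sub_at H p)" and ?u = "top_ob (sub_at K (F p))"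
    let ?\<phi> = "\<lambda>i. last (F (p @ [i]))"
    have p_lev: "code p \<in> lev (path_disk H) ?n" using p by simp
    have fp: "f ?n (code p) = code (F p)" using code_F[OF p] by simp
    have f_Suc: "f (Suc ?n) (code (p @ [i])) = code (F (p @ [i]))" if "i \<le> ?t" for i
      using code_F[of "p @ [i]"] that p by (simp add: is_path_append)
    have in_fiber: "code (p @ [i]) \<in> fiber (path_disk H) ?n (code p)" if "i \<le> ?t" for i
      using that p by (simp add: fiber_path_disk)
    have snoc: "F (p @ [i]) = F p @ [?\<phi> i]" and le: "?\<phi> i \<le> ?u" if i: "i \<le> ?t" for i
    proof -
      have "code (F (p @ [i])) \<in> fiber (path_disk K) ?n (code (F p))"
        using disk_mor_fiber[OF f in_fiber[OF i]] f_Suc[OF i] fp by simp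
      then obtain k where k: "F (p @ [i]) = F p @ [k]" "k \<le> ?u"
        using F_path[OF p] by (auto simp: fiber_path_disk)
      then show "F (p @ [i]) = F p @ [?\<phi> i]" "?\<phi> i \<le> ?u" by auto
    qed
    have mono: "?\<phi> i \<le> ?\<phi> j" if ij: "i \<le> j" "j \<le> ?t" for i j
    proof -
      have i: "i \<le> ?t" using ij by simp
      have "(code (p @ [i]), code (p @ [j])) \<in> ford (path_disk H) ?n (code p)"
        using p ij by (simp add: ford_path_disk)
      then have "(f (Suc ?n) (code (p @ [i])), f (Suc ?n) (code (p @ [j])))
          \<in> ford (path_disk K) ?n (f ?n (code p))"
        using f p_lev in_fiber[OF i] in_fiber[OF ij(2)] unfolding is_disk_mor_def by blast
      then have "(code (F p @ [?\<phi> i]), code (F p @ [?\<phi> j])) \<in> ford (path_disk K) ?n (code (F p))"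
        using f_Suc[OF i] f_Suc[OF ij(2)] snoc[OF i] snoc[OF ij(2)] fp by metis
      then show ?thesis using F_path[OF p] by (simp add: ford_path_disk)
    qed
    have "is_least (fiber (path_disk K) ?n (f ?n (code p))) (ford (path_disk K) ?n (f ?n (code p)))
        (f (Suc ?n) (code (p @ [0])))"
      using f p_lev p is_least_path_disk[OF p refl] unfolding is_disk_mor_def by blast
    then have bot: "?\<phi> 0 = 0"
      using F_path[OF p] f_Suc[of 0] fp by (simp add: is_least_path_disk)
    have "is_greatest (fiber (path_disk K) ?n (f ?n (code p)))
        (ford (path_disk K) ?n (f ?n (code p))) (f (Suc ?n) (code (p @ [?t])))"
      using f p_lev p is_greatest_path_disk[OF p refl] unfolding is_disk_mor_def by blast
    then have top: "?\<phi> ?t = ?u"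
      using F_path[OF p] f_Suc[of ?t] fp by (simp add: is_greatest_path_disk)
    have "interval_map ?t ?u ?\<phi>"
      using le mono bot top by (auto simp: interval_map_def mono_on_def)
    with snoc show "\<exists>\<phi>. interval_map ?t ?u \<phi> \<and> (\<forall>i\<le>?t. F (p @ [i]) = F p @ [\<phi> i])"
      by blast
  qed
  moreover from this have "path_disk_mor H F = f"
  proof (intro disk_mor_ext[OF is_disk_mor_path_disk_mor f])
    fix n x assume "x \<in> lev (path_disk H) n"
    then show "path_disk_mor H F n x = f n x"
      using code_F by (auto simp: lev_path_disk path_disk_mor_code)
  qed
  ultimately show ?thesis by blast
qed

definition path_functor :: "(iobj, imor, 'a disk, nat \<Rightarrow> 'a \<Rightarrow> 'a) funct" where
  "path_functor = \<lparr>on_obj = path_disk, on_mor = (\<lambda>H K g. path_disk_mor H (mor_path g))\<rparr>"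

lemma is_functor_path_functor: "is_functor iI Disk path_functor"
  unfolding is_functor_def
proof (intro conjI ballI)
  fix H assume "H \<in> Obj iI"
  then show "on_obj path_functor H \<in> Obj Disk"
    by (simp add: iI_simps Disk_simps path_functor_def is_disk_path_disk)
next
  fix H K g assume "g \<in> Hom iI H K"
  then show "on_mor path_functor H K g \<in> Hom Disk (on_obj path_functor H) (on_obj path_functor K)"
    by (simp add: iI_simps Disk_simps path_functor_def is_disk_mor_path_disk_mor path_map_mor_path)
next
  fix H assume "H \<in> Obj iI"
  then have "\<And>p. is_path H p \<Longrightarrow> mor_path (iid H) p = p"
    using mor_path_iid by (auto simp: iI_simps)
  then show "on_mor path_functor H H (Ident iI H) = Ident Disk (on_obj path_functor H)"
    by (auto simp: iI_simps Disk_simps path_functor_def path_disk_mor_def lev_path_disk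
        fun_eq_iff restrict_def)
next
  fix H K L f g
  assume "L \<in> Obj iI" "f \<in> Hom iI H K" "g \<in> Hom iI K L"
  then have f: "is_imor H K f" and g: "is_imor K L g" and L: "\<exists>n. has_height n L"
    by (auto simp: iI_simps)
  show "on_mor path_functor H L (Comp iI H K L g f) =
    Comp Disk (on_obj path_functor H) (on_obj path_functor K) (on_obj path_functor L)
      (on_mor path_functor K L g) (on_mor path_functor H K f)"
    using mor_path_icomp[OF f g L] path_map_is_path[OF path_map_mor_path[OF f]]
    by (auto simp: iI_simps Disk_simps path_functor_def path_disk_mor_def lev_path_disk
        fun_eq_iff restrict_def compose_def)
qed

lemma fully_faithful_path_functor: "fully_faithful iI Disk path_functor"
  unfolding fully_faithful_def
proof (rule ballI, rule ballI, rule bij_betwI')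
  fix H K f g assume "f \<in> Hom iI H K" "g \<in> Hom iI H K"
  then have fg: "is_imor H K f" "is_imor H K g" by (auto simp: iI_simps)
  show "on_mor path_functor H K f = on_mor path_functor H K g \<longleftrightarrow> f = g"
  proof
    assume "on_mor path_functor H K f = on_mor path_functor H K g"
    then have eq: "path_disk_mor H (mor_path f) = path_disk_mor H (mor_path g)"
      by (simp add: path_functor_def)
    show "f = g"
    proof (rule is_imor_eqI[OF fg])
      fix p assume p: "is_path H p"
      have "path_disk_mor H (mor_path f) (length p) (code p) =
          path_disk_mor H (mor_path g) (length p) (code p)"
        by (simp only: eq)
      then show "mor_path f p = mor_path g p" using p by (simp add: path_disk_mor_code)
    qed
  qed simp
next
  fix H K g assume "g \<in> Hom iI H K"
  then show "on_mor path_functor H K g \<in> Hom Disk (on_obj path_functor H) (on_obj path_functor K)"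
    by (simp add: iI_simps Disk_simps path_functor_def is_disk_mor_path_disk_mor path_map_mor_path)
next
  fix H K f
  assume "K \<in> Obj iI" "f \<in> Hom Disk (on_obj path_functor H) (on_obj path_functor K)"
  then have K: "\<exists>n. has_height n K" and f: "is_disk_mor (path_disk H) (path_disk K) f"
    by (simp_all add: iI_simps Disk_simps path_functor_def)
  from disk_mor_is_path_disk_mor[OF f] obtain F
    where F: "path_map H K F" "path_disk_mor H F = f" by blast
  from path_map_is_mor_path[OF K F(1)] obtain g
    where g: "is_imor H K g" "\<And>p. is_path H p \<Longrightarrow> mor_path g p = F p" by blast
  then have "path_disk_mor H (mor_path g) = path_disk_mor H F"
    by (auto simp: path_disk_mor_def fun_eq_iff lev_path_disk restrict_def)
  with F(2) g(1) show "\<exists>g\<in>Hom iI H K. f = on_mor path_functor H K g"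
    by (auto simp: iI_simps path_functor_def)
qed

end

section \<open>Every disk is a disk of paths\<close>

lemma interval_structure_enum:
  assumes "interval_structure X r"
  shows "\<exists>m e. bij_betw e {0..m::nat} X \<and> (\<forall>i\<le>m. \<forall>j\<le>m. (e i, e j) \<in> r \<longleftrightarrow> i \<le> j)"
proof -
  from assms obtain m \<phi> where \<phi>: "bij_betw \<phi> X {0..m::nat}"
    "\<forall>x\<in>X. \<forall>y\<in>X. (x, y) \<in> r \<longleftrightarrow> \<phi> x \<le> \<phi> y"
    unfolding interval_structure_def by blast
  have inv: "bij_betw (inv_into X \<phi>) {0..m} X" using \<phi>(1) by (rule bij_betw_inv_into)
  have "(inv_into X \<phi> i, inv_into X \<phi> j) \<in> r \<longleftrightarrow> i \<le> j" if "i \<le> m" "j \<le> m" for i j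
    using \<phi>(2) bij_betwE[OF inv] bij_betw_inv_into_right[OF \<phi>(1)] that by simp
  with inv show ?thesis by blast
qed

text \<open>
  The object represented by the part of a disk above an element \<open>x\<close> of level \<open>n\<close>, given the fibers
  in the form \<open>e n x 0, \<dots>, e n x (t n x)\<close>. The recursion is bounded by the number \<open>k\<close> of levels
  that are taken into account; this loses nothing if the degree is at most \<open>n + k\<close>, as then all
  fibers that are cut off are singletons.
\<close>

primrec unfold_obj ::
    "(nat \<Rightarrow> 'a \<Rightarrow> nat) \<Rightarrow> (nat \<Rightarrow> 'a \<Rightarrow> nat \<Rightarrow> 'a) \<Rightarrow> nat \<Rightarrow> nat \<Rightarrow> 'a \<Rightarrow> iobj" where
  "unfold_obj t e 0 n x = Trivial"
| "unfold_obj t e (Suc k) n x = (if t n x = 0 then Trivial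
    else Node (map (\<lambda>i. unfold_obj t e k (Suc n) (e n x i)) [0..<Suc (t n x)]))"

primrec walk :: "(nat \<Rightarrow> 'a \<Rightarrow> nat \<Rightarrow> 'a) \<Rightarrow> nat \<Rightarrow> 'a \<Rightarrow> nat list \<Rightarrow> 'a" where
  "walk e n x [] = x"
| "walk e n x (i # p) = walk e (Suc n) (e n x i) p"

lemma walk_append: "walk e n x (p @ q) = walk e (n + length p) (walk e n x p) q"
  by (induction p arbitrary: n x) auto

text \<open>
  Fixing an enumeration \<open>e n x\<close> of every fiber, in place of the mere existence of one, makes it
  possible to read off objects and to follow paths by recursion.
\<close>

locale enumerated_disk =
  fixes A :: "'a disk" and root :: 'a and N :: nat
    and t :: "nat \<Rightarrow> 'a \<Rightarrow> nat" and e :: "nat \<Rightarrow> 'a \<Rightarrow> nat \<Rightarrow> 'a"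
  assumes disk: "is_disk A" and root: "lev A 0 = {root}"
    and enum: "x \<in> lev A n \<Longrightarrow> bij_betw (e n x) {0..t n x} (fiber A n x)"
    and enum_ford: "x \<in> lev A n \<Longrightarrow> i \<le> t n x \<Longrightarrow> j \<le> t n x \<Longrightarrow>
      (e n x i, e n x j) \<in> ford A n x \<longleftrightarrow> i \<le> j"
    and degree: "has_degree A N"
begin

abbreviation "obj \<equiv> unfold_obj t e"

lemma e_fiber: "x \<in> lev A n \<Longrightarrow> i \<le> t n x \<Longrightarrow> e n x i \<in> fiber A n x"
  using bij_betwE[OF enum] by simp

lemma e_lev: "x \<in> lev A n \<Longrightarrow> i \<le> t n x \<Longrightarrow> e n x i \<in> lev A (Suc n)"
  and proj_e: "x \<in> lev A n \<Longrightarrow> i \<le> t n x \<Longrightarrow> proj A n (e n x i) = x"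
  using e_fiber by (auto simp: fiber_def)

lemma fiber_eq: "x \<in> lev A n \<Longrightarrow> fiber A n x = e n x ` {0..t n x}"
  using enum by (simp add: bij_betw_def)

lemma e_inj: "x \<in> lev A n \<Longrightarrow> i \<le> t n x \<Longrightarrow> j \<le> t n x \<Longrightarrow> e n x i = e n x j \<Longrightarrow> i = j"
  using enum unfolding bij_betw_def inj_on_def by simp

lemma linear: "x \<in> lev A n \<Longrightarrow> linear_order_on (fiber A n x) (ford A n x)"
  using disk by (simp add: is_disk_def interval_structure_def)

lemma e_least: "x \<in> lev A n \<Longrightarrow> is_least (fiber A n x) (ford A n x) (e n x 0)"
  unfolding is_least_def by (auto simp: fiber_eq enum_ford)

lemma e_greatest: "x \<in> lev A n \<Longrightarrow> is_greatest (fiber A n x) (ford A n x) (e n x (t n x))"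
  unfolding is_greatest_def by (auto simp: fiber_eq enum_ford)

text \<open>
  The axiom on \<open>d\<^sub>0\<close> and \<open>d\<^sub>1\<close> in terms of sizes of fibers: the sections are \<open>e n x 0\<close> and
  \<open>e n x (t n x)\<close>, which agree exactly if the fiber is a singleton.
\<close>

lemma t_root: "t 0 root \<noteq> 0"
  and t_e: "x \<in> lev A n \<Longrightarrow> i \<le> t n x \<Longrightarrow> t (Suc n) (e n x i) = 0 \<longleftrightarrow> i = 0 \<or> i = t n x"
proof -
  \<comment> \<open>the name \<open>ends\<close> hides the axiom while the quantified sections are eliminated\<close>
  define ends where "ends d\<^sub>0 d\<^sub>1 \<longleftrightarrow>
    (\<forall>n. \<forall>x\<in>lev A n. is_least (fiber A n x) (ford A n x) (d\<^sub>0 n x) \<and>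
      is_greatest (fiber A n x) (ford A n x) (d\<^sub>1 n x)) \<and>
    {x \<in> lev A 0. d\<^sub>0 0 x = d\<^sub>1 0 x} = {} \<and>
    (\<forall>n. {x \<in> lev A (Suc n). d\<^sub>0 (Suc n) x = d\<^sub>1 (Suc n) x} =
      d\<^sub>0 n ` lev A n \<union> d\<^sub>1 n ` lev A n)" for d\<^sub>0 d\<^sub>1
  have "\<exists>d\<^sub>0 d\<^sub>1. ends d\<^sub>0 d\<^sub>1"
    using disk unfolding is_disk_def ends_def by (elim conjE)
  then obtain d\<^sub>0 d\<^sub>1 where "ends d\<^sub>0 d\<^sub>1" by blast
  then have ends: "\<forall>n. \<forall>x\<in>lev A n. is_least (fiber A n x) (ford A n x) (d\<^sub>0 n x) \<and>
      is_greatest (fiber A n x) (ford A n x) (d\<^sub>1 n x)"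
    and d_root: "{x \<in> lev A 0. d\<^sub>0 0 x = d\<^sub>1 0 x} = {}"
    and d_Suc: "\<And>n. {x \<in> lev A (Suc n). d\<^sub>0 (Suc n) x = d\<^sub>1 (Suc n) x} =
        d\<^sub>0 n ` lev A n \<union> d\<^sub>1 n ` lev A n"
    unfolding ends_def by simp_all
  from ends have d\<^sub>0: "d\<^sub>0 n x = e n x 0" and d\<^sub>1: "d\<^sub>1 n x = e n x (t n x)" if "x \<in> lev A n" for n x
    using that is_least_unique[OF linear[OF that] _ e_least[OF that]]
      is_greatest_unique[OF linear[OF that] _ e_greatest[OF that]] by blast+
  have "d\<^sub>0 0 root \<noteq> d\<^sub>1 0 root" using d_root root by blast
  then show "t 0 root \<noteq> 0" using d\<^sub>0[of root 0] d\<^sub>1[of root 0] root by (metis singletonI)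
  assume x: "x \<in> lev A n" and i: "i \<le> t n x"
  let ?y = "e n x i"
  have y: "?y \<in> lev A (Suc n)" using x i by (rule e_lev)
  have "t (Suc n) ?y = 0 \<longleftrightarrow> d\<^sub>0 (Suc n) ?y = d\<^sub>1 (Suc n) ?y"
    using e_inj[OF y, of 0 "t (Suc n) ?y"] d\<^sub>0[OF y] d\<^sub>1[OF y] by auto
  also have "\<dots> \<longleftrightarrow> ?y \<in> d\<^sub>0 n ` lev A n \<union> d\<^sub>1 n ` lev A n"
    using d_Suc[of n] y by blast
  also have "\<dots> \<longleftrightarrow> (\<exists>x'\<in>lev A n. ?y = e n x' 0 \<or> ?y = e n x' (t n x'))"
    using d\<^sub>0 d\<^sub>1 by auto
  also have "\<dots> \<longleftrightarrow> ?y = e n x 0 \<or> ?y = e n x (t n x)"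
  proof
    assume "\<exists>x'\<in>lev A n. ?y = e n x' 0 \<or> ?y = e n x' (t n x')"
    then obtain x' where x': "x' \<in> lev A n" "?y = e n x' 0 \<or> ?y = e n x' (t n x')" by blast
    then have "proj A n ?y = x'" using proj_e[OF x'(1)] by auto
    with x i x' show "?y = e n x 0 \<or> ?y = e n x (t n x)" by (simp add: proj_e)
  qed (use x in blast)
  also have "\<dots> \<longleftrightarrow> i = 0 \<or> i = t n x"
    using e_inj[OF x i] by auto
  finally show "t (Suc n) ?y = 0 \<longleftrightarrow> i = 0 \<or> i = t n x" .
qed

text \<open>
  The projection from level \<open>n + 1\<close> is the first factor of the composite down to level \<open>N\<close>, which is
  bijective.
\<close>

lemma proj_inj_above_degree:
  assumes "N \<le> n"
  shows "inj_on (proj A n) (lev A (Suc n))"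
proof -
  define m where "m = n - N"
  have n: "n = N + m" using assms by (simp add: m_def)
  have "inj_on (proj_comp A N (Suc m)) (lev A (N + Suc m))"
    using degree unfolding has_degree_def bij_betw_def by (metis le_add1 plus_1_eq_Suc)
  then have "inj_on (proj_comp A N m \<circ> proj A n) (lev A (Suc n))" by (simp add: n)
  then show ?thesis by (rule inj_on_imageI2)
qed

lemma t_above_degree:
  assumes "N \<le> n" "x \<in> lev A n"
  shows "t n x = 0"
proof -
  have "e n x 0 = e n x (t n x)"
    by (rule inj_onD[OF proj_inj_above_degree[OF assms(1)]]) (use assms in \<open>simp_all add: e_lev proj_e\<close>)
  with e_inj[OF assms(2), of 0 "t n x"] show ?thesis by simp
qed

lemma obj_Trivial:
  assumes "t n x = 0"
  shows "obj k n x = Trivial"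
  using assms by (cases k) auto

lemma top_ob_obj: "N \<le> n + k \<Longrightarrow> x \<in> lev A n \<Longrightarrow> top_ob (obj k n x) = t n x"
  by (cases k) (auto simp: t_above_degree)

text \<open>
  If the fiber over \<open>x\<close> is a singleton, then both sides are trivial: its only element is an
  endpoint, so the next fiber is a singleton too.
\<close>

lemma sub_obj:
  assumes "N \<le> n + k" "x \<in> lev A n" "i \<le> t n x"
  shows "sub (obj k n x) i = obj (k - 1) (Suc n) (e n x i)"
proof (cases "t n x = 0")
  case True
  with t_e[OF assms(2,3)] assms(3) show ?thesis by (simp add: obj_Trivial)
next
  case False
  with t_above_degree assms(1,2) obtain l where "k = Suc l" by (cases k) auto
  with False assms(3) show ?thesis by (simp del: upt_Suc)
qed

lemma has_height_obj:
  assumes "N \<le> n + k" "x \<in> lev A n"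
  shows "\<exists>l\<le>k. has_height l (obj k n x)"
  using assms
proof (induction k arbitrary: n x)
  case 0
  then show ?case by (simp add: has_height.trivial)
next
  case (Suc k)
  let ?H = "obj (Suc k) n x"
  show ?case
  proof (cases "t n x = 0")
    case True
    then show ?thesis using has_height.trivial by auto
  next
    case False
    let ?Hs = "map (\<lambda>i. obj k (Suc n) (e n x i)) [0..<Suc (t n x)]"
    have H: "?H = Node ?Hs" using False by simp
    have child: "sub (Node ?Hs) i = obj k (Suc n) (e n x i)" "e n x i \<in> lev A (Suc n)"
      if "i \<in> Ob (Node ?Hs)" for i
      using that Suc.prems(2) e_lev by (auto simp: Ob_def simp del: upt_Suc)
    have "has_height (Suc k) (Node ?Hs)"
    proof (rule has_height.node)
      show "2 \<le> length ?Hs" using False by simp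
      show "\<forall>i\<in>Ob (Node ?Hs). \<exists>l<Suc k. has_height l (sub (Node ?Hs) i)"
        using Suc.IH[of "Suc n"] Suc.prems(1) child by (simp add: less_Suc_eq_le del: sub.simps)
      show "\<forall>i\<in>Ob (Node ?Hs). sub (Node ?Hs) i = Trivial \<longleftrightarrow> i = 0 \<or> i = top_ob (Node ?Hs)"
      proof
        fix i assume i: "i \<in> Ob (Node ?Hs)"
        then have le: "i \<le> t n x" by (simp add: Ob_def)
        have "sub (Node ?Hs) i = Trivial \<longleftrightarrow> t (Suc n) (e n x i) = 0"
          using child[OF i] top_ob_obj[of "Suc n" k "e n x i"] Suc.prems(1) obj_Trivial
          by (metis add_Suc add_Suc_right top_ob.simps(1))
        with t_e[OF Suc.prems(2) le] show
          "sub (Node ?Hs) i = Trivial \<longleftrightarrow> i = 0 \<or> i = top_ob (Node ?Hs)" by simp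
      qed
    qed simp
    with H show ?thesis by auto
  qed
qed

text \<open>
  Following a path through the unfolded object and through the disk are the same process, so the
  object reached along \<open>p\<close> unfolds the part of the disk above the element reached along \<open>p\<close>.
\<close>

lemma walk_sub_at:
  assumes "N \<le> n + k" "x \<in> lev A n" "is_path (obj k n x) p"
  shows "walk e n x p \<in> lev A (n + length p) \<and>
    sub_at (obj k n x) p = obj (k - length p) (n + length p) (walk e n x p)"
  using assms
proof (induction p arbitrary: k n x)
  case (Cons i p)
  then have i: "i \<le> t n x" by (simp add: top_ob_obj)
  note sub = sub_obj[OF Cons.prems(1,2) i]
  have "N \<le> Suc n + (k - 1)" using Cons.prems(1) by simp
  from Cons.IH[OF this e_lev[OF Cons.prems(2) i]] Cons.prems(3) sub
  show ?case by simp
qed simp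

definition total_obj :: iobj where
  "total_obj = obj N 0 root"

lemma total_obj: "\<exists>n. has_height n total_obj" "total_obj \<noteq> Trivial"
proof -
  show "\<exists>n. has_height n total_obj"
    using has_height_obj[of 0 N root] root by (auto simp: total_obj_def)
  have "top_ob total_obj \<noteq> 0"
    using top_ob_obj[of 0 N root] root t_root by (simp add: total_obj_def)
  then show "total_obj \<noteq> Trivial" by auto
qed

abbreviation "walk_root \<equiv> walk e 0 root"

lemma walk_root_lev: "is_path total_obj p \<Longrightarrow> walk_root p \<in> lev A (length p)"
  and top_ob_sub_at: "is_path total_obj p \<Longrightarrow>
    top_ob (sub_at total_obj p) = t (length p) (walk_root p)"
proof -
  assume "is_path total_obj p"
  with walk_sub_at[of 0 N root p] root
  have w: "walk_root p \<in> lev A (length p)"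
    "sub_at total_obj p = obj (N - length p) (length p) (walk_root p)"
    by (auto simp: total_obj_def)
  then show "walk_root p \<in> lev A (length p)"
    and "top_ob (sub_at total_obj p) = t (length p) (walk_root p)"
    by (simp_all add: top_ob_obj)
qed

lemma walk_root_snoc: "walk_root (p @ [i]) = e (length p) (walk_root p) i"
  by (simp add: walk_append)

text \<open>
  A map of trees that is bijective on roots and on all fibers is bijective on every level.
\<close>

lemma walk_root_bij: "bij_betw walk_root {p. is_path total_obj p \<and> length p = n} (lev A n)"
proof (induction n)
  case 0
  have "{p. is_path total_obj p \<and> length p = 0} = {[]}" by auto
  then show ?case by (simp add: root bij_betw_def)
next
  case (Suc n)
  show ?case
  proof (rule bij_betwI')
    fix p q
    assume "p \<in> {p. is_path total_obj p \<and> length p = Suc n}"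
      "q \<in> {p. is_path total_obj p \<and> length p = Suc n}"
    then have "is_path total_obj p" "length p = Suc n" "is_path total_obj q" "length q = Suc n"
      by auto
    then obtain p' i q' j
      where p: "p = p' @ [i]" "is_path total_obj p'" "length p' = n" "i \<le> top_ob (sub_at total_obj p')"
        and q: "q = q' @ [j]" "is_path total_obj q'" "length q' = n" "j \<le> top_ob (sub_at total_obj q')"
      by (metis path_SucE)
    then have ij: "i \<le> t n (walk_root p')" "j \<le> t n (walk_root q')"
      using top_ob_sub_at by auto
    have lev: "walk_root p' \<in> lev A n" "walk_root q' \<in> lev A n"
      using walk_root_lev[of p'] walk_root_lev[of q'] p q by simp_all
    show "walk_root p = walk_root q \<longleftrightarrow> p = q"
    proof
      assume eq: "walk_root p = walk_root q"
      then have "proj A n (e n (walk_root p') i) = proj A n (e n (walk_root q') j)"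
        using p q by (simp add: walk_root_snoc)
      then have "walk_root p' = walk_root q'"
        using proj_e[OF lev(1) ij(1)] proj_e[OF lev(2) ij(2)] by simp
      then have "p' = q'" using Suc.IH p q unfolding bij_betw_def inj_on_def by simp
      with eq e_inj[OF lev(1)] p q ij show "p = q" by (simp add: walk_root_snoc)
    qed simp
  next
    fix p assume "p \<in> {p. is_path total_obj p \<and> length p = Suc n}"
    then show "walk_root p \<in> lev A (Suc n)" using walk_root_lev[of p] by auto
  next
    fix y assume y: "y \<in> lev A (Suc n)"
    define x where "x = proj A n y"
    have x: "x \<in> lev A n" using disk is_tree_proj y by (auto simp: is_disk_def x_def)
    then have "x \<in> walk_root ` {p. is_path total_obj p \<and> length p = n}"
      using bij_betw_imp_surj_on[OF Suc.IH] by simp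
    then obtain p where p: "is_path total_obj p" "length p = n" "walk_root p = x" by auto
    from y have "y \<in> fiber A n x" by (simp add: fiber_def x_def)
    then have "y \<in> e n x ` {0..t n x}" by (simp only: fiber_eq[OF x])
    then obtain i where i: "i \<le> t n x" "e n x i = y" by auto
    with p have "is_path total_obj (p @ [i])" "walk_root (p @ [i]) = y"
      by (simp_all add: is_path_append top_ob_sub_at walk_root_snoc)
    with p show "\<exists>q\<in>{p. is_path total_obj p \<and> length p = Suc n}. y = walk_root q"
      by (intro bexI[of _ "p @ [i]"]) auto
  qed
qed

end

lemma enumerated_disk_exists:
  assumes A: "is_disk A"
  shows "\<exists>root N t e. enumerated_disk A root N t e"
proof -
  from A obtain root N where root: "lev A 0 = {root}" and N: "has_degree A N"
    by (auto simp: is_disk_def is_tree_def finite_degree_def)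
  have "\<forall>n x. \<exists>m e. x \<in> lev A n \<longrightarrow> bij_betw e {0..m::nat} (fiber A n x) \<and>
      (\<forall>i\<le>m. \<forall>j\<le>m. (e i, e j) \<in> ford A n x \<longleftrightarrow> i \<le> j)"
    using A interval_structure_enum unfolding is_disk_def by meson
  then obtain t e where "\<forall>n x. x \<in> lev A n \<longrightarrow> bij_betw (e n x) {0..t n x::nat} (fiber A n x) \<and>
      (\<forall>i\<le>t n x. \<forall>j\<le>t n x. (e n x i, e n x j) \<in> ford A n x \<longleftrightarrow> i \<le> j)"
    by metis
  with A root N have "enumerated_disk A root N t e" by unfold_locales auto
  then show ?thesis by blast
qed

context path_coding
begin

text \<open>
  Walking along paths is an isomorphism from the disk of paths of \<open>total_obj\<close> to the given disk:
  on each fiber it is the enumeration \<open>e\<close>.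
\<close>

lemma path_disk_iso:
  assumes A: "is_disk A"
  shows "\<exists>H. (\<exists>n. has_height n H) \<and> H \<noteq> Trivial \<and> (\<exists>h. is_iso Disk A (path_disk H) h)"
proof -
  from enumerated_disk_exists[OF A] obtain root N t e where "enumerated_disk A root N t e" by blast
  then interpret enumerated_disk A root N t e .
  let ?H = total_obj
  define f where "f n = (\<lambda>x\<in>lev (path_disk ?H) n. walk_root (decode x))" for n
  have f_code: "f n (code p) = walk_root p" if "is_path ?H p" "length p = n" for n p
    using that by (simp add: f_def)
  have f_snoc: "f (Suc n) (code (p @ [i])) = e n (walk_root p) i"
    if "is_path ?H p" "length p = n" "i \<le> t n (walk_root p)" for n p i
    using that by (simp add: f_code is_path_append top_ob_sub_at walk_root_snoc)
  have mor: "is_disk_mor (path_disk ?H) A f"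
    unfolding is_disk_mor_def
  proof (intro conjI allI ballI impI)
    fix n show "f n \<in> lev (path_disk ?H) n \<rightarrow>\<^sub>E lev A n"
      using walk_root_lev by (auto simp: f_def lev_path_disk)
  next
    fix n y assume "y \<in> lev (path_disk ?H) (Suc n)"
    then obtain p i where p: "y = code (p @ [i])" "is_path ?H p" "length p = n"
      "i \<le> top_ob (sub_at ?H p)" by (rule lev_SucE)
    then have "is_path ?H (p @ [i])" by (simp add: is_path_append)
    with p show "proj A n (f (Suc n) y) = f n (proj (path_disk ?H) n y)"
      using walk_root_lev[OF p(2)] by (simp add: f_code walk_root_snoc top_ob_sub_at proj_e)
  next
    fix n x y z
    assume "x \<in> lev (path_disk ?H) n"
      and "y \<in> fiber (path_disk ?H) n x" "z \<in> fiber (path_disk ?H) n x"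
      and "(y, z) \<in> ford (path_disk ?H) n x"
    then obtain p i j where "x = code p" "is_path ?H p" "length p = n"
      "y = code (p @ [i])" "z = code (p @ [j])" "i \<le> j" "j \<le> t n (walk_root p)"
      by (auto simp: lev_path_disk fiber_path_disk ford_path_disk top_ob_sub_at)
    then show "(f (Suc n) y, f (Suc n) z) \<in> ford A n (f n x)"
      using walk_root_lev by (auto simp: f_code f_snoc enum_ford)
  next
    fix n x y
    assume "x \<in> lev (path_disk ?H) n"
      and "is_least (fiber (path_disk ?H) n x) (ford (path_disk ?H) n x) y"
    then obtain p where "x = code p" "is_path ?H p" "length p = n" "y = code (p @ [0])"
      by (auto simp: lev_path_disk is_least_path_disk)
    then show "is_least (fiber A n (f n x)) (ford A n (f n x)) (f (Suc n) y)"
      using walk_root_lev by (auto simp: f_code f_snoc e_least)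
  next
    fix n x y
    assume "x \<in> lev (path_disk ?H) n"
      and "is_greatest (fiber (path_disk ?H) n x) (ford (path_disk ?H) n x) y"
    then obtain p where "x = code p" "is_path ?H p" "length p = n"
      "y = code (p @ [t n (walk_root p)])"
      by (auto simp: lev_path_disk is_greatest_path_disk top_ob_sub_at)
    then show "is_greatest (fiber A n (f n x)) (ford A n (f n x)) (f (Suc n) y)"
      using walk_root_lev by (auto simp: f_code f_snoc e_greatest)
  qed
  have "bij_betw (f n) (lev (path_disk ?H) n) (lev A n)" for n
  proof -
    let ?P = "{p. is_path ?H p \<and> length p = n}"
    have "bij_betw decode (code ` ?P) ?P"
      by (auto simp: bij_betw_def inj_on_def image_image)
    from bij_betw_trans[OF this walk_root_bij]
    have "bij_betw (walk_root \<circ> decode) (lev (path_disk ?H) n) (lev A n)"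
      by (simp only: lev_path_disk)
    then show ?thesis
      by (rule iffD1[OF bij_betw_cong, rotated]) (simp add: f_def)
  qed
  with disk_iso_if_bij[OF is_disk_path_disk[OF total_obj] A mor] total_obj show ?thesis by blast
qed

lemma essentially_surjective_path_functor: "essentially_surjective iI Disk path_functor"
  using path_disk_iso
  by (auto simp: essentially_surjective_def iI_simps Disk_simps path_functor_def)

end

section \<open>The equivalence\<close>

theorem corollary4p9:
  assumes "infinite (UNIV :: 'a set)"
  shows "equivalent_categories (Disk :: ('a disk, nat \<Rightarrow> 'a \<Rightarrow> 'a) cat) iI"
proof -
  from assms obtain c :: "nat \<Rightarrow> 'a" where "inj c"
    using infinite_countable_subset by blast
  then have "path_coding (c \<circ> to_nat)"
    by unfold_locales (simp add: inj_compose)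
  then interpret path_coding "c \<circ> to_nat" .
  show ?thesis
    using category_iI category_Disk is_functor_path_functor fully_faithful_path_functor
      essentially_surjective_path_functor
    by (rule equivalent_categories_if_fully_faithful)
qed

end
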